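(* Assume that there is a base measure $m'$ on $\Xi'$ with $O_\xi\ll m'$ for all $\xi\in\Xi$, and a measurable function $d:\Xi\times\Xi'\to\mathbb R$ with $\frac{dO_\xi}{dm'}(\xi')=\exp(-d(\xi,\xi'))$ for all $\xi\in\Xi$, $\xi'\in\Xi'$. Then the rate function $I(\hat P',P)=\mathrm{KL}(\hat P',O\star P)$ is jointly convex in $(\hat P',P)$ and, for $\hat P'\in\mathcal P(\Xi')$ and $P\in\mathcal P(\Xi)$, it can be decomposed as $$I(\hat P',P)=\inf_{Q\in\mathcal P(\Xi)}\Big\{\mathrm{KL}(Q,P)+\mathrm{KL}(\hat P',m')+W_1(\hat P',Q)\Big\}\ \ge 0 .$$
   Context: $\Xi,\Xi'$ are Polish spaces; $\mathcal P(\cdot)$ denotes Borel probability measures. $O:\Xi\to\mathcal P(\Xi')$, $\xi\mapsto O_\xi$, is an observational model (the law of a noisy observation given the noiseless observation $\xi$), and $(O\star P)(B)=\int O_\xi(B)\,dP(\xi)$ for Borel $B\subseteq\Xi'$. The entropic divergence between two finite measures $\mu$ and $\nu$ on the same space is $$\mathrm{KL}(\mu,\nu)=\int\log\left(\frac{d\mu}{d\nu}\right)d\mu-\int d\mu+\int d\nu\quad\text{if }\mu\ll\nu,\qquad \mathrm{KL}(\mu,\nu)=+\infty\ \text{otherwise};$$ the same notation is used for $\mathrm{KL}(\hat P',m')$. Entropic optimal transport with cost $d$ and regularization parameter $1$: for $\hat P'\in\mathcal P(\Xi')$ and $Q\in\mathcal P(\Xi)$, $$W_1(\hat P',Q)=\inf_{T\in\mathcal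 T(\hat P',Q)}\int_{\Xi\times\Xi'}d(\xi,\xi')\,dT(\xi,\xi')+\mathrm{KL}(T,\Pi_\Xi T\otimes\Pi_{\Xi'}T),$$ where $\Pi_\Xi T,\Pi_{\Xi'}T$ are the marginals of $T$ and $\mathcal T(\hat P',Q)=\{T\in\mathcal P(\Xi\times\Xi'):\Pi_{\Xi'}T=\hat P',\ \Pi_\Xi T=Q\}$.
   Formalization: KL(P',m') is taken without the mass terms -1+m'(Ξ') (the formula fails otherwise unless m' has mass 1); if ∫d dT + KL in W_1 is undefined, both are put under one integral; the decomposition is claimed only when KL(P',m') and its sum with W_1(P',Q) are defined for all Q with KL(Q,P) finite. *)

theory Defs
  imports "HOL-Probability.Probability"
begin

definition borel_probs :: "'a::topological_space measure set" where
  "borel_probs = {P. sets P = sets borel \<and> prob_space P}"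

text \<open>
  The integral of a real function with values in the extended reals. It is the usual integral for
  quasi-integrable functions (those for which the integral is not of the form
  \<open>\<infinity> - \<infinity>\<close>); otherwise it has the junk value \<open>\<infinity>\<close>.
\<close>

definition ereal_integral :: "'a measure \<Rightarrow> ('a \<Rightarrow> real) \<Rightarrow> ereal" where
  "ereal_integral M f =
     enn2ereal (\<integral>\<^sup>+x. ennreal (f x) \<partial>M) - enn2ereal (\<integral>\<^sup>+x. ennreal (- f x) \<partial>M)"

definition quasi_integrable :: "'a measure \<Rightarrow> ('a \<Rightarrow> real) \<Rightarrow> bool" where
  "quasi_integrable M f \<longleftrightarrow>
     (\<integral>\<^sup>+x. ennreal (f x) \<partial>M) < \<infinity> \<or> (\<integral>\<^sup>+x. ennreal (- f x) \<partial>M) < \<infinity>"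

definition sum_defined :: "ereal \<Rightarrow> ereal \<Rightarrow> bool" where
  "sum_defined a b \<longleftrightarrow> \<not> (a = \<infinity> \<and> b = - \<infinity>) \<and> \<not> (a = - \<infinity> \<and> b = \<infinity>)"

text \<open>\<open>log_ratio \<mu> \<nu>\<close> is \<open>log (d\<mu>/d\<nu>)\<close>; note that the library relation
  \<open>absolutely_continuous \<nu> \<mu>\<close> and \<open>RN_deriv \<nu> \<mu>\<close> take the dominating measure first.\<close>

definition log_ratio :: "'a measure \<Rightarrow> 'a measure \<Rightarrow> 'a \<Rightarrow> real" where
  "log_ratio \<mu> \<nu> x = ln (enn2real (RN_deriv \<nu> \<mu> x))"

text \<open>
  \<open>rel_entropy\<close> is the divergence without the total mass terms. It is the meaning of
  \<open>KL(\<mu>, \<nu>)\<close> when \<open>\<mu>\<close> is a probability measure and \<open>\<nu>\<close> a base measure that need not be a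
  probability measure, or even finite (such as Lebesgue measure). It agrees with \<open>KL\<close> when both
  arguments are probability measures.
\<close>

definition rel_entropy :: "'a measure \<Rightarrow> 'a measure \<Rightarrow> ereal" where
  "rel_entropy \<mu> \<nu> =
     (if absolutely_continuous \<nu> \<mu> then ereal_integral \<mu> (log_ratio \<mu> \<nu>) else \<infinity>)"

definition KL :: "'a measure \<Rightarrow> 'a measure \<Rightarrow> ereal" where
  "KL \<mu> \<nu> =
     (if absolutely_continuous \<nu> \<mu>
      then ereal_integral \<mu> (log_ratio \<mu> \<nu>)
             - enn2ereal (emeasure \<mu> (space \<mu>)) + enn2ereal (emeasure \<nu> (space \<nu>))
      else \<infinity>)"

lemma KL_eq_rel_entropy:
  assumes "prob_space \<mu>" "prob_space \<nu>"
  shows "KL \<mu> \<nu> = rel_entropy \<mu> \<nu>"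
proof -
  have "a - 1 + 1 = a" for a :: ereal
    by (cases a) (auto simp: one_ereal_def)
  then show ?thesis
    using assms by (simp add: KL_def rel_entropy_def prob_space.emeasure_space_1 one_ennreal.rep_eq)
qed

definition rel_entropy_defined :: "'a measure \<Rightarrow> 'a measure \<Rightarrow> bool" where
  "rel_entropy_defined \<mu> \<nu> \<longleftrightarrow>
     (absolutely_continuous \<nu> \<mu> \<longrightarrow> quasi_integrable \<mu> (log_ratio \<mu> \<nu>))"

text \<open>The rate function. The law \<open>O \<star> P\<close> is the library's monadic bind of \<open>P\<close> with the kernel.\<close>

definition rate :: "('a \<Rightarrow> 'b measure) \<Rightarrow> 'b measure \<Rightarrow> 'a measure \<Rightarrow> ereal" where
  "rate Obs P' P = KL P' (P \<bind> Obs)"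

lemma emeasure_observation:
  assumes "Obs \<in> borel \<rightarrow>\<^sub>M prob_algebra borel" "P \<in> borel_probs" "B \<in> sets borel"
  shows "emeasure (P \<bind> Obs) B = (\<integral>\<^sup>+\<xi>. emeasure (Obs \<xi>) B \<partial>P)"
proof (rule emeasure_bind[where N = borel])
  have "sets P = sets borel" "prob_space P"
    using assms(2) by (auto simp: borel_probs_def)
  then show "space P \<noteq> {}" "Obs \<in> P \<rightarrow>\<^sub>M subprob_algebra borel"
    using measurable_prob_algebraD[OF assms(1)] prob_space.not_empty
    by (auto cong: measurable_cong_sets)
qed fact

definition mixture :: "real \<Rightarrow> 'a measure \<Rightarrow> 'a measure \<Rightarrow> 'a measure" where
  "mixture t \<mu> \<nu> = measure_of (space \<mu>) (sets \<mu>)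
     (\<lambda>A. ennreal (1 - t) * emeasure \<mu> A + ennreal t * emeasure \<nu> A)"

lemma sets_mixture: "sets (mixture t \<mu> \<nu>) = sets \<mu>"
  unfolding mixture_def by (rule sets.sets_measure_of_eq)

lemma emeasure_mixture:
  assumes "sets \<mu> = sets \<nu>" "A \<in> sets \<mu>"
  shows "emeasure (mixture t \<mu> \<nu>) A = ennreal (1 - t) * emeasure \<mu> A + ennreal t * emeasure \<nu> A"
proof (rule emeasure_measure_of[OF mixture_def])
  show "countably_additive (sets (mixture t \<mu> \<nu>))
          (\<lambda>A. ennreal (1 - t) * emeasure \<mu> A + ennreal t * emeasure \<nu> A)"
  proof (rule countably_additiveI)
    fix F :: "nat \<Rightarrow> 'a set"
    assume F: "range F \<subseteq> sets (mixture t \<mu> \<nu>)" "disjoint_family F"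
    have "range F \<subseteq> sets \<mu>" "range F \<subseteq> sets \<nu>"
      using F(1) assms(1) by (simp_all add: sets_mixture)
    then show "(\<Sum>i. ennreal (1 - t) * emeasure \<mu> (F i) + ennreal t * emeasure \<nu> (F i))
        = ennreal (1 - t) * emeasure \<mu> (\<Union>(range F)) + ennreal t * emeasure \<nu> (\<Union>(range F))"
      using F(2) by (simp add: suminf_add[symmetric] suminf_emeasure)
  qed
  show "positive (sets (mixture t \<mu> \<nu>))
          (\<lambda>A. ennreal (1 - t) * emeasure \<mu> A + ennreal t * emeasure \<nu> A)"
    by (simp add: positive_def)
qed (use assms sets.space_closed in \<open>auto simp: sets_mixture\<close>)

text \<open>\<open>couplings P' Q\<close> is \<open>\<T>(P', Q)\<close>: the first coordinate (in the noiseless space) has law \<open>Q\<close>,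
  the second one has law \<open>P'\<close>.\<close>

definition couplings ::
    "'b::topological_space measure \<Rightarrow> 'a::topological_space measure \<Rightarrow> ('a \<times> 'b) measure set" where
  "couplings P' Q = {T \<in> borel_probs. distr T borel snd = P' \<and> distr T borel fst = Q}"

text \<open>
  The objective of the transport problem is \<open>\<integral>d dT + KL(T, \<Pi>T \<otimes> \<Pi>'T)\<close> whenever this
  expression has a meaning. The cost is not bounded below, so the integral may be undefined, or
  equal to \<open>-\<infinity>\<close> while the divergence is \<open>\<infinity>\<close>. In these cases the two terms are combined into the
  single integral \<open>\<integral>(d + log (dT/d(\<Pi>T \<otimes> \<Pi>'T))) dT\<close>, which has the same value as the sum when the
  sum has a meaning. No fixed value of \<open>\<infinity> - \<infinity>\<close> would do: the only couplings that come close to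
  the infimum may be of this kind.
\<close>

definition eot_objective ::
    "('a::topological_space \<times> 'b::topological_space \<Rightarrow> real) \<Rightarrow> ('a \<times> 'b) measure \<Rightarrow> ereal" where
  "eot_objective d T =
     (let R = distr T borel fst \<Otimes>\<^sub>M distr T borel snd in
      if quasi_integrable T d \<and> sum_defined (ereal_integral T d) (KL T R)
      then ereal_integral T d + KL T R
      else if absolutely_continuous R T then ereal_integral T (\<lambda>z. d z + log_ratio T R z)
      else \<infinity>)"

definition eot ::
    "('a::topological_space \<times> 'b::topological_space \<Rightarrow> real) \<Rightarrow> 'b measure \<Rightarrow> 'a measure \<Rightarrow> ereal"
  where "eot d P' Q = (INF T\<in>couplings P' Q. eot_objective d T)"

end

theory Submission
  imports Defs
begin

text \<open>
  The proof rests on the joint law \<open>J\<close> of the noiseless and the noisy observation,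
  \<open>J(d\<xi>, d\<xi>') = P(d\<xi>) O\<^sub>\<xi>(d\<xi>') = exp (- d) P(d\<xi>) m'(d\<xi>')\<close>, whose marginals are \<open>P\<close> and \<open>O \<star> P\<close>.

  Let \<open>T\<close> be a coupling of \<open>Q\<close> and \<open>P'\<close>. Factoring the density of \<open>T\<close> with respect to \<open>J\<close> through the
  product of its marginals gives, \<open>T\<close>-almost everywhere,
  \<open>log dT/dJ = (d + log dT/d(Q \<otimes> P')) + log dQ/dP + log dP'/dm'\<close> (\<open>log_ratio_chain\<close>). Integrated over
  \<open>T\<close>, this says that \<open>KL(T, J)\<close> is the sum of the transport objective of \<open>T\<close>, of \<open>KL(Q, P)\<close> and of
  \<open>KL(P', m')\<close>. The infimum over \<open>Q\<close> and \<open>T\<close> is therefore the infimum of \<open>KL(T, J)\<close> over all \<open>T\<close> whose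
  second marginal is \<open>P'\<close>. Divergence decreases under projections (\<open>KL_distr_le\<close>), so this infimum
  is at least \<open>KL(P', O \<star> P)\<close>. It is attained by reweighting \<open>J\<close> with the function
  \<open>dP'/d(O \<star> P)\<close> of the second coordinate (\<open>tilted_coupling\<close>): the density of that \<open>T\<close> depends on
  \<open>\<xi>'\<close> only, so the projection loses nothing. Projection to the first coordinate also bounds its
  \<open>KL(Q, P)\<close> by \<open>KL(P', O \<star> P)\<close>, so \<open>KL(Q, P)\<close> is finite when the rate is.

  The cost is unbounded in both directions, so the integrated identity needs care with infinite values.
  \<open>KL(T, J)\<close> is nonnegative and only laws \<open>Q\<close> with finite \<open>KL(Q, P)\<close> matter, so the identity can fail
  only where \<open>KL(P', m')\<close> is infinite. If \<open>P'\<close> is not absolutely continuous with respect to \<open>m'\<close>,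
  both sides are \<open>\<infinity>\<close>. Otherwise, if \<open>KL(P', m')\<close> is \<open>-\<infinity>\<close>, every coupling of \<open>P\<close> and \<open>P'\<close> has
  objective \<open>\<infinity>\<close>. If it is \<open>\<infinity>\<close> while the rate is finite,
  the reweighted coupling has objective \<open>-\<infinity>\<close>. The assumption on the sums excludes both.

  Nonnegativity, joint convexity and monotonicity under projections come from one inequality,
  \<open>\<integral>log h dP \<le> KL(P, N) + \<integral>h dN - 1\<close> (\<open>entropy_variational\<close>), with equality for \<open>h = dP/dN\<close>: for
  a mixture or a projection, the optimal \<open>h\<close> is inserted into the inequality for the original measures.
\<close>

section \<open>Integrals with values in the extended reals\<close>

text \<open>
  The convention \<open>\<infinity> - \<infinity> = \<infinity>\<close> keeps extended subtraction monotone in its first and antitone in its second argument.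
\<close>

lemma ereal_integral_mono_AE:
  assumes "AE x in M. f x \<le> g x"
  shows "ereal_integral M f \<le> ereal_integral M g"
  unfolding ereal_integral_def
proof (rule ereal_minus_mono)
  show "enn2ereal (\<integral>\<^sup>+x. ennreal (f x) \<partial>M) \<le> enn2ereal (\<integral>\<^sup>+x. ennreal (g x) \<partial>M)"
    using assms by (auto simp flip: less_eq_ennreal.rep_eq intro!: nn_integral_mono_AE ennreal_leI)
  show "enn2ereal (\<integral>\<^sup>+x. ennreal (- g x) \<partial>M) \<le> enn2ereal (\<integral>\<^sup>+x. ennreal (- f x) \<partial>M)"
    using assms by (auto simp flip: less_eq_ennreal.rep_eq intro!: nn_integral_mono_AE ennreal_leI)
qed

lemma ereal_integral_cong_AE:
  assumes "AE x in M. f x = g x"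
  shows "ereal_integral M f = ereal_integral M g"
  using assms by (intro antisym ereal_integral_mono_AE) auto

lemma ereal_integral_eq_integral:
  assumes "integrable M f"
  shows "ereal_integral M f = ereal (integral\<^sup>L M f)"
  using assms by (rule integrableE) (simp add: ereal_integral_def)

lemma integrable_imp_quasi_integrable: "integrable M f \<Longrightarrow> quasi_integrable M f"
  by (simp add: quasi_integrable_def real_integrable_def less_top)

lemma integrable_if_ereal_integral_finite:
  assumes "f \<in> borel_measurable M" "quasi_integrable M f"
    and "ereal_integral M f \<noteq> \<infinity>" "ereal_integral M f \<noteq> -\<infinity>"
  shows "integrable M f"
  using assms unfolding real_integrable_def ereal_integral_def quasi_integrable_def
  by (cases "\<integral>\<^sup>+x. ennreal (f x) \<partial>M"; cases "\<integral>\<^sup>+x. ennreal (- f x) \<partial>M") auto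

lemma quasi_integrable_uminus:
  "quasi_integrable M (\<lambda>x. - f x) \<longleftrightarrow> quasi_integrable M f"
  by (auto simp: quasi_integrable_def)

lemma ereal_integral_uminus:
  assumes "quasi_integrable M f"
  shows "ereal_integral M (\<lambda>x. - f x) = - ereal_integral M f"
  using assms unfolding ereal_integral_def quasi_integrable_def
  by (cases "\<integral>\<^sup>+x. ennreal (f x) \<partial>M"; cases "\<integral>\<^sup>+x. ennreal (- f x) \<partial>M") auto

text \<open>
  Since each summand is quasi-integrable and the sum of the integrals is meaningful, either both positive
  parts or both negative parts have finite integral. The identity
  \<open>(f + g)\<^sup>+ + f\<^sup>- + g\<^sup>- = (f + g)\<^sup>- + f\<^sup>+ + g\<^sup>+\<close> then transfers to the integrals.
\<close>

lemma ereal_integral_add: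
  assumes [measurable]: "f \<in> borel_measurable M" "g \<in> borel_measurable M"
    and qf: "quasi_integrable M f" and qg: "quasi_integrable M g"
    and def: "sum_defined (ereal_integral M f) (ereal_integral M g)"
  shows "quasi_integrable M (\<lambda>x. f x + g x)"
    and "ereal_integral M (\<lambda>x. f x + g x) = ereal_integral M f + ereal_integral M g"
proof -
  define Fp Fn Gp Gn Sp Sn where I:
    "Fp = (\<integral>\<^sup>+x. ennreal (f x) \<partial>M)" "Fn = (\<integral>\<^sup>+x. ennreal (- f x) \<partial>M)"
    "Gp = (\<integral>\<^sup>+x. ennreal (g x) \<partial>M)" "Gn = (\<integral>\<^sup>+x. ennreal (- g x) \<partial>M)"
    "Sp = (\<integral>\<^sup>+x. ennreal (f x + g x) \<partial>M)" "Sn = (\<integral>\<^sup>+x. ennreal (- (f x + g x)) \<partial>M)"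
  have pos_part: "ennreal (max 0 a) = ennreal a" for a :: real
    by (simp add: max_def ennreal_neg)
  have "ennreal (max 0 (f x + g x)) + ennreal (max 0 (- f x)) + ennreal (max 0 (- g x)) =
      ennreal (max 0 (- (f x + g x))) + ennreal (max 0 (f x)) + ennreal (max 0 (g x))" for x
    by (simp flip: ennreal_plus add: max_def)
  then have "ennreal (f x + g x) + ennreal (- f x) + ennreal (- g x) =
      ennreal (- (f x + g x)) + ennreal (f x) + ennreal (g x)" for x
    unfolding pos_part .
  then have "(\<integral>\<^sup>+x. ennreal (f x + g x) + ennreal (- f x) + ennreal (- g x) \<partial>M) =
     (\<integral>\<^sup>+x. ennreal (- (f x + g x)) + ennreal (f x) + ennreal (g x) \<partial>M)"
    by simp
  then have eq: "Sp + Fn + Gn = Sn + Fp + Gp"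
    unfolding I by (simp add: nn_integral_add)
  have "ennreal (a + b) \<le> ennreal a + ennreal b" for a b :: real
    by (cases "0 \<le> a"; cases "0 \<le> b") (auto simp: ennreal_neg intro!: ennreal_leI)
  from this[of "f _" "g _"] this[of "- f _" "- g _"]
  have "Sp \<le> Fp + Gp" "Sn \<le> Fn + Gn"
    unfolding I by (auto simp flip: nn_integral_add intro!: nn_integral_mono)
  note le = this
  have fin: "Fp < \<infinity> \<or> Fn < \<infinity>" "Gp < \<infinity> \<or> Gn < \<infinity>"
    using qf qg unfolding quasi_integrable_def I by auto
  have sd: "sum_defined (enn2ereal Fp - enn2ereal Fn) (enn2ereal Gp - enn2ereal Gn)"
    using def unfolding ereal_integral_def I .
  have "Fp < \<infinity> \<and> Gp < \<infinity> \<or> Fn < \<infinity> \<and> Gn < \<infinity>"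
    using fin sd unfolding sum_defined_def
    by (cases Fp; cases Fn; cases Gp; cases Gn) auto
  then have "Sp < \<infinity> \<or> Sn < \<infinity>"
    using le by (auto intro: le_less_trans)
  then show "quasi_integrable M (\<lambda>x. f x + g x)"
    unfolding quasi_integrable_def I .
  have "enn2ereal Sp - enn2ereal Sn =
     (enn2ereal Fp - enn2ereal Fn) + (enn2ereal Gp - enn2ereal Gn)"
    using eq le fin sd unfolding sum_defined_def
    by (cases Fp; cases Fn; cases Gp; cases Gn; cases Sp; cases Sn)
      (auto simp flip: ennreal_plus simp: top_unique)
  then show "ereal_integral M (\<lambda>x. f x + g x) = ereal_integral M f + ereal_integral M g"
    unfolding ereal_integral_def I .
qed

section \<open>Relative entropy\<close>

lemma AE_RN_deriv_pos_finite:
  assumes "finite_measure P" "sigma_finite_measure N" "sets P = sets N" "absolutely_continuous N P"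
  shows "AE x in P. 0 < RN_deriv N P x \<and> RN_deriv N P x < \<infinity>"
proof -
  interpret N: sigma_finite_measure N by fact
  obtain D where D: "AE x in N. RN_deriv N P x = ennreal (D x)" "AE x in P. 0 < D x"
    using N.real_RN_deriv[OF assms(1,4,3)] by metis
  have "AE x in P. RN_deriv N P x = ennreal (D x)"
    by (rule absolutely_continuous_AE[OF assms(3,4) D(1)])
  with D(2) show ?thesis
    by eventually_elim simp
qed

lemma integral_RN_deriv_prob:
  assumes "prob_space P" "sigma_finite_measure N" "sets P = sets N" "absolutely_continuous N P"
  shows "integrable N (\<lambda>x. enn2real (RN_deriv N P x))" "(\<integral>x. enn2real (RN_deriv N P x) \<partial>N) = 1"
proof -
  interpret P: prob_space P by fact
  interpret N: sigma_finite_measure N by fact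
  show "integrable N (\<lambda>x. enn2real (RN_deriv N P x))"
    using N.RN_deriv_integrable[OF P.sigma_finite_measure_axioms assms(4,3), of "\<lambda>_. 1"] by simp
  show "(\<integral>x. enn2real (RN_deriv N P x) \<partial>N) = 1"
    using N.RN_deriv_integral[OF P.sigma_finite_measure_axioms assms(4,3), of "\<lambda>_. 1"]
    by (simp add: P.prob_space)
qed

text \<open>
  With \<open>f = dP/dN\<close>, the inequality \<open>log (h / f) \<le> h / f - 1\<close> bounds \<open>log h\<close> by \<open>log f + k - 1\<close> for \<open>k = h / f\<close>,
  and \<open>\<integral>k dP \<le> \<integral>h dN\<close> because \<open>f k \<le> h\<close>. Stated pointwise with an integrable \<open>k\<close>, it yields
  integrability of \<open>log h\<close> as well as inequalities between integrals.
\<close>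

lemma young_entropy:
  fixes h :: "'a \<Rightarrow> real"
  assumes "prob_space P" "sigma_finite_measure N" and sets: "sets P = sets N"
    and ac: "absolutely_continuous N P"
    and h: "integrable N h" "\<And>x. 0 \<le> h x"
  obtains k where "integrable P k" "\<And>x. 0 \<le> k x" "integral\<^sup>L P k \<le> integral\<^sup>L N h"
    "AE x in P. 0 < h x \<longrightarrow> ln (h x) \<le> log_ratio P N x + k x - 1"
proof
  interpret P: prob_space P by fact
  interpret N: sigma_finite_measure N by fact
  have [measurable]: "h \<in> borel_measurable N"
    using h by auto
  note [measurable_cong] = sets
  define f where "f = (\<lambda>x. enn2real (RN_deriv N P x))"
  have [measurable]: "f \<in> borel_measurable N"
    unfolding f_def by measurable
  have "AE x in N. RN_deriv N P x \<noteq> \<infinity>"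
    by (rule N.RN_deriv_finite[OF P.sigma_finite_measure_axioms ac sets])
  then have Nf: "AE x in N. RN_deriv N P x = ennreal (f x)"
    by eventually_elim (simp add: f_def less_top)
  have pos: "AE x in P. 0 < f x"
    using AE_RN_deriv_pos_finite[OF P.finite_measure_axioms N.sigma_finite_measure_axioms sets ac]
    by eventually_elim (auto simp: f_def enn2real_positive_iff)
  let ?k = "\<lambda>x. h x / f x"
  show k: "\<And>x. 0 \<le> ?k x"
    using h(2) by (simp add: f_def)
  have "(\<integral>\<^sup>+x. ennreal (?k x) \<partial>P) = (\<integral>\<^sup>+x. RN_deriv N P x * ennreal (?k x) \<partial>N)"
    using ac sets by (intro N.RN_deriv_nn_integral) auto
  also have "\<dots> \<le> (\<integral>\<^sup>+x. ennreal (h x) \<partial>N)"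
  proof (intro nn_integral_mono_AE, use Nf in eventually_elim)
    case (elim x)
    have "RN_deriv N P x * ennreal (?k x) = ennreal (f x * ?k x)"
      unfolding elim by (rule ennreal_mult[symmetric]) (use k in \<open>auto simp: f_def\<close>)
    also have "\<dots> \<le> ennreal (h x)"
      using h(2) by (intro ennreal_leI) simp
    finally show ?case .
  qed
  finally have le: "(\<integral>\<^sup>+x. ennreal (?k x) \<partial>P) \<le> (\<integral>\<^sup>+x. ennreal (h x) \<partial>N)" .
  moreover have hI: "(\<integral>\<^sup>+x. ennreal (h x) \<partial>N) = ennreal (integral\<^sup>L N h)"
    using h by (simp add: nn_integral_eq_integral)
  ultimately show kI: "integrable P ?k"
    using k by (intro integrableI_nonneg) (auto intro: le_less_trans)
  show "integral\<^sup>L P ?k \<le> integral\<^sup>L N h"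
    using le k h unfolding hI nn_integral_eq_integral[OF kI AE_I2[OF k]]
    by (subst (asm) ennreal_le_iff) auto
  show "AE x in P. 0 < h x \<longrightarrow> ln (h x) \<le> log_ratio P N x + ?k x - 1"
    using pos
  proof eventually_elim
    case (elim x)
    then show ?case
      using ln_le_minus_one[of "h x / f x"] by (auto simp: log_ratio_def ln_div simp flip: f_def)
        (simp add: f_def)
  qed
qed

text \<open>
  The case \<open>h = 1\<close> of Young's inequality bounds \<open>- log (dP/dN)\<close> by an integrable function. Hence a divergence
  between probability measures is never \<open>\<infinity> - \<infinity>\<close>.
\<close>

lemma nn_integral_neg_log_ratio_finite:
  assumes "prob_space P" "prob_space N" "sets P = sets N" "absolutely_continuous N P"
  shows "(\<integral>\<^sup>+x. ennreal (- log_ratio P N x) \<partial>P) < \<infinity>"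
proof -
  interpret N: prob_space N by fact
  obtain k where k: "integrable P k" "\<And>x. 0 \<le> k x"
    "AE x in P. 0 < (1::real) \<longrightarrow> ln (1::real) \<le> log_ratio P N x + k x - 1"
    using young_entropy[OF assms(1) N.sigma_finite_measure_axioms assms(3,4), of "\<lambda>_. 1"] by auto
  have "(\<integral>\<^sup>+x. ennreal (- log_ratio P N x) \<partial>P) \<le> (\<integral>\<^sup>+x. ennreal (k x) \<partial>P)"
    using k(3) by (intro nn_integral_mono_AE, eventually_elim) (auto intro: ennreal_leI)
  also have "\<dots> < \<infinity>"
    using k by (simp add: nn_integral_eq_integral)
  finally show ?thesis .
qed

lemma KL_eq_ereal_integral:
  assumes "prob_space P" "prob_space N" "absolutely_continuous N P"
  shows "KL P N = ereal_integral P (log_ratio P N)"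
  using assms by (simp add: KL_eq_rel_entropy rel_entropy_def)

lemma borel_measurable_log_ratio [measurable]: "log_ratio P N \<in> borel_measurable N"
  unfolding log_ratio_def by measurable

lemma KL_finiteD:
  assumes P: "prob_space P" and N: "prob_space N" and sets: "sets P = sets N" and fin: "KL P N < \<infinity>"
  shows "absolutely_continuous N P" "integrable P (log_ratio P N)"
    "KL P N = ereal (\<integral>x. log_ratio P N x \<partial>P)"
proof -
  show ac: "absolutely_continuous N P"
    using fin by (auto simp: KL_def split: if_splits)
  note [measurable_cong] = sets
  note neg = nn_integral_neg_log_ratio_finite[OF P N sets ac]
  have "ereal_integral P (log_ratio P N) \<noteq> \<infinity>"
    using fin KL_eq_ereal_integral[OF P N ac] by simp
  moreover have "ereal_integral P (log_ratio P N) \<noteq> - \<infinity>"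
    using neg unfolding ereal_integral_def
    by (cases "\<integral>\<^sup>+x. ennreal (log_ratio P N x) \<partial>P"; cases "\<integral>\<^sup>+x. ennreal (- log_ratio P N x) \<partial>P") auto
  ultimately show I: "integrable P (log_ratio P N)"
    using neg by (intro integrable_if_ereal_integral_finite) (auto simp: quasi_integrable_def)
  show "KL P N = ereal (\<integral>x. log_ratio P N x \<partial>P)"
    using KL_eq_ereal_integral[OF P N ac] I by (simp add: ereal_integral_eq_integral)
qed

lemma KL_self:
  assumes "prob_space P"
  shows "KL P P = 0"
proof -
  interpret prob_space P by fact
  have "AE x in P. 1 = RN_deriv P P x"
    by (rule RN_deriv_unique) (simp_all add: density_1)
  then have "ereal_integral P (log_ratio P P) = ereal_integral P (\<lambda>_. 0)"
    by (intro ereal_integral_cong_AE, eventually_elim) (metis enn2real_1 ln_one log_ratio_def)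
  moreover have "absolutely_continuous P P"
    by (simp add: absolutely_continuous_def)
  ultimately show ?thesis
    using KL_eq_ereal_integral[OF assms assms] by (simp add: ereal_integral_def)
qed

text \<open>
  One direction of the Donsker-Varadhan formula, in the form that is affine in \<open>N\<close>: the normalization
  term is \<open>\<integral>h dN - 1\<close> in place of \<open>log (\<integral>h dN)\<close>, which makes it compatible with mixtures of \<open>N\<close>.
\<close>

lemma entropy_variational:
  assumes P: "prob_space P" and N: "prob_space N" and sets: "sets P = sets N"
    and h: "integrable N h" "\<And>x. 0 \<le> h x" "AE x in P. 0 < h x"
  shows "ereal_integral P (\<lambda>x. ln (h x)) \<le> KL P N + ereal (integral\<^sup>L N h - 1)"
proof (cases "KL P N < \<infinity>")
  case True
  interpret P: prob_space P by fact
  interpret N: prob_space N by fact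
  note KL = KL_finiteD[OF P N sets True]
  obtain k where k: "integrable P k" "\<And>x. 0 \<le> k x" "integral\<^sup>L P k \<le> integral\<^sup>L N h"
    "AE x in P. 0 < h x \<longrightarrow> ln (h x) \<le> log_ratio P N x + k x - 1"
    using young_entropy[OF P N.sigma_finite_measure_axioms sets KL(1) h(1,2)] by blast
  have "ereal_integral P (\<lambda>x. ln (h x)) \<le> ereal_integral P (\<lambda>x. log_ratio P N x + k x - 1)"
    using k(4) h(3) by (intro ereal_integral_mono_AE, eventually_elim) auto
  also have "\<dots> = ereal ((\<integral>x. log_ratio P N x \<partial>P) + integral\<^sup>L P k - 1)"
    using k KL by (subst ereal_integral_eq_integral) (auto simp: P.prob_space)
  also have "\<dots> \<le> KL P N + ereal (integral\<^sup>L N h - 1)"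
    using k(3) unfolding KL(3) by simp
  finally show ?thesis .
qed simp

lemma KL_nonneg:
  assumes "prob_space P" "prob_space N" "sets P = sets N"
  shows "0 \<le> KL P N"
proof -
  interpret N: prob_space N by fact
  show ?thesis
    using entropy_variational[OF assms, of "\<lambda>_. 1"]
    by (simp add: ereal_integral_def N.prob_space zero_ereal_def[symmetric])
qed

lemma absolutely_continuous_distr:
  assumes sets: "sets P = sets N" and ac: "absolutely_continuous N P" and X [measurable]: "X \<in> N \<rightarrow>\<^sub>M K"
  shows "absolutely_continuous (distr N K X) (distr P K X)"
  unfolding absolutely_continuous_def
proof
  note [measurable_cong] = sets
  fix A assume "A \<in> null_sets (distr N K X)"
  then have "A \<in> sets K" "X -` A \<inter> space N \<in> null_sets N"
    by (auto simp: null_sets_def emeasure_distr)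
  then have "X -` A \<inter> space N \<in> null_sets P"
    using ac by (auto simp: absolutely_continuous_def)
  then show "A \<in> null_sets (distr P K X)"
    using \<open>A \<in> sets K\<close> sets_eq_imp_space_eq[OF sets]
    by (auto simp: null_sets_def emeasure_distr)
qed

text \<open>
  The data processing inequality. The optimal function for the image measures, their density \<open>r\<close>, is pulled
  back along \<open>X\<close>: \<open>h = r \<circ> X\<close> has \<open>N\<close>-integral 1, and the \<open>P\<close>-integral of its logarithm is the divergence
  of the images.
\<close>

lemma KL_distr_le:
  assumes P: "prob_space P" and N: "prob_space N" and sets: "sets P = sets N"
    and X [measurable]: "X \<in> N \<rightarrow>\<^sub>M K"
  shows "KL (distr P K X) (distr N K X) \<le> KL P N"
proof (cases "absolutely_continuous N P")
  case ac: True
  note [measurable_cong] = sets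
  interpret P: prob_space P by fact
  interpret N: prob_space N by fact
  let ?P = "distr P K X" and ?N = "distr N K X"
  interpret P': prob_space ?P by (rule P.prob_space_distr) simp
  interpret N': prob_space ?N by (rule N.prob_space_distr) simp
  have ac': "absolutely_continuous ?N ?P"
    by (rule absolutely_continuous_distr[OF sets ac X])
  let ?r = "RN_deriv ?N ?P"
  have [measurable]: "?r \<in> borel_measurable K"
    using borel_measurable_RN_deriv[of ?N ?P] by simp
  have "AE x in ?P. 0 < ?r x \<and> ?r x < \<infinity>"
    by (rule AE_RN_deriv_pos_finite[OF P'.finite_measure_axioms N'.sigma_finite_measure_axioms _ ac'])
       simp
  then have "AE x in ?P. 0 < enn2real (?r x)"
    by eventually_elim (simp add: enn2real_positive_iff)
  then have pos: "AE x in P. 0 < enn2real (?r (X x))"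
    by (simp add: AE_distr_iff)
  note r = integral_RN_deriv_prob[OF P'.prob_space_axioms N'.sigma_finite_measure_axioms _ ac', simplified]
  have I: "integrable N (\<lambda>x. enn2real (?r (X x)))" "(\<integral>x. enn2real (?r (X x)) \<partial>N) = 1"
    using r by (simp_all add: integrable_distr_eq integral_distr)
  have "KL ?P ?N = ereal_integral ?P (log_ratio ?P ?N)"
    by (rule KL_eq_ereal_integral[OF P'.prob_space_axioms N'.prob_space_axioms ac'])
  also have "\<dots> = ereal_integral P (\<lambda>x. ln (enn2real (?r (X x))))"
    unfolding ereal_integral_def log_ratio_def by (simp add: nn_integral_distr)
  also have "\<dots> \<le> KL P N + ereal ((\<integral>x. enn2real (?r (X x)) \<partial>N) - 1)"
    by (rule entropy_variational[OF P N sets I(1) _ pos]) simp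
  finally show ?thesis
    by (simp add: I(2) zero_ereal_def[symmetric])
qed (simp add: KL_def)

section \<open>Mixtures and joint convexity\<close>

lemma space_mixture [simp]: "space (mixture t \<mu> \<nu>) = space \<mu>"
  by (rule sets_eq_imp_space_eq) (rule sets_mixture)

lemma mixture_0: "sets \<mu> = sets \<nu> \<Longrightarrow> mixture 0 \<mu> \<nu> = \<mu>"
  by (rule measure_eqI) (simp_all add: sets_mixture emeasure_mixture)

lemma mixture_1: "sets \<mu> = sets \<nu> \<Longrightarrow> mixture 1 \<mu> \<nu> = \<nu>"
  by (rule measure_eqI) (simp_all add: sets_mixture emeasure_mixture)

lemma nn_integral_mixture:
  assumes sets: "sets \<mu> = sets \<nu>" and f: "f \<in> borel_measurable \<mu>"
  shows "(\<integral>\<^sup>+x. f x \<partial>mixture t \<mu> \<nu>) =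
    ennreal (1 - t) * (\<integral>\<^sup>+x. f x \<partial>\<mu>) + ennreal t * (\<integral>\<^sup>+x. f x \<partial>\<nu>)"
  using f
proof (induction rule: borel_measurable_induct)
  case (cong f g)
  then have "(\<integral>\<^sup>+x. f x \<partial>M) = (\<integral>\<^sup>+x. g x \<partial>M)" if "space M = space \<mu>" for M
    using that by (intro nn_integral_cong) auto
  then show ?case
    using cong(4) sets_eq_imp_space_eq[OF sets] by simp
next
  case (set A)
  then show ?case
    using sets by (simp add: emeasure_mixture sets_mixture)
next
  case (mult u c)
  have [measurable]: "u \<in> borel_measurable \<mu>" "u \<in> borel_measurable \<nu>" "u \<in> borel_measurable (mixture t \<mu> \<nu>)"
    using mult(2) sets by (auto cong: measurable_cong_sets simp: sets_mixture)
  show ?case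
    by (simp add: nn_integral_cmult mult.IH algebra_simps)
next
  case (add u v)
  have [measurable]: "u \<in> borel_measurable \<mu>" "u \<in> borel_measurable \<nu>" "u \<in> borel_measurable (mixture t \<mu> \<nu>)"
    using add(1) sets by (auto cong: measurable_cong_sets simp: sets_mixture)
  have [measurable]: "v \<in> borel_measurable \<mu>" "v \<in> borel_measurable \<nu>" "v \<in> borel_measurable (mixture t \<mu> \<nu>)"
    using \<open>v \<in> borel_measurable \<mu>\<close> sets by (auto cong: measurable_cong_sets simp: sets_mixture)
  show ?case
    by (simp add: nn_integral_add add.IH algebra_simps)
next
  case (seq U)
  have [measurable]: "U i \<in> borel_measurable \<mu>" "U i \<in> borel_measurable \<nu>"
      "U i \<in> borel_measurable (mixture t \<mu> \<nu>)" for i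
    using seq(1) sets by (auto cong: measurable_cong_sets simp: sets_mixture)
  have inc: "incseq (\<lambda>i. c * (\<integral>\<^sup>+x. U i x \<partial>M))" for M and c :: ennreal
    using seq(3) by (auto simp: incseq_def le_fun_def intro!: mult_left_mono nn_integral_mono)
  have "(\<integral>\<^sup>+x. (SUP i. U i x) \<partial>mixture t \<mu> \<nu>) = (SUP i. \<integral>\<^sup>+x. U i x \<partial>mixture t \<mu> \<nu>)"
    using seq(3) by (intro nn_integral_monotone_convergence_SUP) auto
  also have "\<dots> = (SUP i. ennreal (1 - t) * (\<integral>\<^sup>+x. U i x \<partial>\<mu>) + ennreal t * (\<integral>\<^sup>+x. U i x \<partial>\<nu>))"
    by (simp add: seq.IH)
  also have "\<dots> = (SUP i. ennreal (1 - t) * (\<integral>\<^sup>+x. U i x \<partial>\<mu>)) + (SUP i. ennreal t * (\<integral>\<^sup>+x. U i x \<partial>\<nu>))"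
    by (intro ennreal_SUP_add inc)
  also have "\<dots> = ennreal (1 - t) * (\<integral>\<^sup>+x. (SUP i. U i x) \<partial>\<mu>) + ennreal t * (\<integral>\<^sup>+x. (SUP i. U i x) \<partial>\<nu>)"
    using seq(3) by (simp add: SUP_mult_left_ennreal nn_integral_monotone_convergence_SUP)
  finally show ?case
    by (simp add: image_comp SUP_apply)
qed

lemma prob_space_mixture:
  assumes "prob_space \<mu>" "prob_space \<nu>" "sets \<mu> = sets \<nu>" "0 \<le> t" "t \<le> 1"
  shows "prob_space (mixture t \<mu> \<nu>)"
proof
  have "ennreal (1 - t) + ennreal t = 1"
    using assms by (simp flip: ennreal_plus)
  moreover have "emeasure \<mu> (space \<mu>) = 1" "emeasure \<nu> (space \<mu>) = 1"
    using assms prob_space.emeasure_space_1 sets_eq_imp_space_eq[OF assms(3)] by metis+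
  ultimately show "emeasure (mixture t \<mu> \<nu>) (space (mixture t \<mu> \<nu>)) = 1"
    by (simp add: emeasure_mixture[OF assms(3)])
qed

lemma absolutely_continuous_mixture:
  assumes "sets \<mu> = sets \<nu>" "0 < t" "t < 1"
  shows "absolutely_continuous (mixture t \<mu> \<nu>) \<mu>" "absolutely_continuous (mixture t \<mu> \<nu>) \<nu>"
  using assms
  by (auto simp: absolutely_continuous_def null_sets_def sets_mixture emeasure_mixture ennreal_eq_0_iff)

lemma integral_mixture:
  assumes sets: "sets \<mu> = sets \<nu>" and t: "0 \<le> t" "t \<le> 1"
    and f: "integrable \<mu> f" "integrable \<nu> (f :: _ \<Rightarrow> real)"
  shows "integrable (mixture t \<mu> \<nu>) f"
    and "integral\<^sup>L (mixture t \<mu> \<nu>) f = (1 - t) * integral\<^sup>L \<mu> f + t * integral\<^sup>L \<nu> f"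
proof -
  obtain a b where ab: "0 \<le> a" "0 \<le> b" "(\<integral>\<^sup>+x. ennreal (f x) \<partial>\<mu>) = ennreal a"
    "(\<integral>\<^sup>+x. ennreal (- f x) \<partial>\<mu>) = ennreal b" "integral\<^sup>L \<mu> f = a - b"
    using f(1) by (rule integrableE)
  obtain c d where cd: "0 \<le> c" "0 \<le> d" "(\<integral>\<^sup>+x. ennreal (f x) \<partial>\<nu>) = ennreal c"
    "(\<integral>\<^sup>+x. ennreal (- f x) \<partial>\<nu>) = ennreal d" "integral\<^sup>L \<nu> f = c - d"
    using f(2) by (rule integrableE)
  have [measurable]: "f \<in> borel_measurable \<mu>"
    using f by simp
  then have [measurable]: "f \<in> borel_measurable (mixture t \<mu> \<nu>)"
    by (simp cong: measurable_cong_sets add: sets_mixture)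
  have eq: "(\<integral>\<^sup>+x. ennreal (f x) \<partial>mixture t \<mu> \<nu>) = ennreal ((1 - t) * a + t * c)"
    "(\<integral>\<^sup>+x. ennreal (- f x) \<partial>mixture t \<mu> \<nu>) = ennreal ((1 - t) * b + t * d)"
    using sets t ab cd by (simp_all add: nn_integral_mixture ennreal_mult ennreal_plus)
  then show I: "integrable (mixture t \<mu> \<nu>) f"
    by (simp add: real_integrable_def)
  show "integral\<^sup>L (mixture t \<mu> \<nu>) f = (1 - t) * integral\<^sup>L \<mu> f + t * integral\<^sup>L \<nu> f"
  proof -
    have "0 \<le> (1 - t) * a + t * c" "0 \<le> (1 - t) * b + t * d"
      using t ab(1,2) cd(1,2) by simp_all
    then show ?thesis
      unfolding real_lebesgue_integral_def[OF I] eq ab(5) cd(5)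
      by (simp only: enn2real_ennreal) (simp add: algebra_simps)
  qed
qed

text \<open>
  Let \<open>f\<close> be the density of the mixed \<open>P\<close> with respect to the mixed \<open>N\<close>. The divergence of the mixtures is
  \<open>\<integral>log f\<close> against the mixed \<open>P\<close>, hence the weighted average of the integrals against \<open>P1\<close> and \<open>P2\<close>. Each of these is bounded
  by the variational inequality for the pair \<open>P\<^sub>i, N\<^sub>i\<close> with the same \<open>h = f\<close>, and the error terms
  \<open>\<integral>f dN\<^sub>i - 1\<close> average to zero since \<open>f\<close> has integral 1 against the mixed \<open>N\<close>.
\<close>

lemma KL_mixture_le:
  assumes P: "prob_space P1" "prob_space P2" and N: "prob_space N1" "prob_space N2"
    and sets: "sets P1 = sets N1" "sets P2 = sets N1" "sets N2 = sets N1"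
    and t: "0 \<le> t" "t \<le> 1"
  shows "KL (mixture t P1 P2) (mixture t N1 N2) \<le> ereal (1 - t) * KL P1 N1 + ereal t * KL P2 N2"
proof -
  let ?P = "mixture t P1 P2" and ?N = "mixture t N1 N2"
  have nonneg: "0 \<le> KL P1 N1" "0 \<le> KL P2 N2"
    using KL_nonneg P N sets by metis+
  consider "t = 0" | "t = 1" | "0 < t" "t < 1" "KL P1 N1 = \<infinity> \<or> KL P2 N2 = \<infinity>"
    | "0 < t" "t < 1" "KL P1 N1 < \<infinity>" "KL P2 N2 < \<infinity>"
    using t by fastforce
  then show ?thesis
  proof cases
    case 1
    then show ?thesis
      using sets by (simp add: mixture_0 zero_ereal_def[symmetric] one_ereal_def[symmetric])
  next
    case 2
    then show ?thesis
      using sets by (simp add: mixture_1 zero_ereal_def[symmetric] one_ereal_def[symmetric])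
  next
    case 3
    then have "ereal (1 - t) * KL P1 N1 + ereal t * KL P2 N2 = \<infinity>"
      using nonneg by (cases "KL P1 N1"; cases "KL P2 N2") auto
    then show ?thesis
      by (metis ereal_less_eq(1))
  next
    case 4
    note KL1 = KL_finiteD[OF P(1) N(1) sets(1) 4(3)]
    note KL2 = KL_finiteD[OF P(2) N(2) _ 4(4), unfolded sets, OF refl]
    have sP: "sets P1 = sets P2" and sN: "sets N1 = sets N2"
      using sets by simp_all
    interpret P: prob_space ?P
      by (rule prob_space_mixture[OF P sP t])
    interpret N: prob_space ?N
      by (rule prob_space_mixture[OF N sN t])
    have sPN: "sets ?P = sets ?N"
      using sets by (simp add: sets_mixture)
    have ac: "absolutely_continuous ?N ?P"
      using KL1(1) KL2(1) 4 sets
      by (auto simp: absolutely_continuous_def null_sets_def sets_mixture emeasure_mixture ennreal_eq_0_iff)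
    note acP = absolutely_continuous_mixture[OF sP 4(1,2)]
    define f where "f = (\<lambda>x. enn2real (RN_deriv ?N ?P x))"
    have f0: "0 \<le> f x" for x
      by (simp add: f_def)
    have "f \<in> borel_measurable ?N"
      unfolding f_def by measurable
    then have [measurable]: "f \<in> borel_measurable N1" "f \<in> borel_measurable N2" "f \<in> borel_measurable P1"
        "f \<in> borel_measurable P2"
      using sets by (simp_all cong: measurable_cong_sets add: sets_mixture)
    note fN = integral_RN_deriv_prob[OF P.prob_space_axioms N.sigma_finite_measure_axioms sPN ac, folded f_def]
    have "(\<integral>\<^sup>+x. ennreal (f x) \<partial>?N) < \<infinity>"
      using fN f0 by (simp add: nn_integral_eq_integral)
    then have "(\<integral>\<^sup>+x. ennreal (f x) \<partial>N1) < \<infinity>" "(\<integral>\<^sup>+x. ennreal (f x) \<partial>N2) < \<infinity>"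
      using 4 sN by (auto simp: nn_integral_mixture ennreal_mult_less_top ennreal_eq_0_iff)
    then have fN1: "integrable N1 f" and fN2: "integrable N2 f"
      using f0 by (auto intro!: integrableI_nonneg)
    have f1: "(1 - t) * integral\<^sup>L N1 f + t * integral\<^sup>L N2 f = 1"
      using integral_mixture(2)[OF sN t fN1 fN2] fN(2) by simp
    have pos: "AE x in ?P. 0 < f x"
      using AE_RN_deriv_pos_finite[OF P.finite_measure_axioms N.sigma_finite_measure_axioms sPN ac]
      by eventually_elim (simp add: f_def enn2real_positive_iff)
    have pos1: "AE x in P1. 0 < f x"
      by (rule absolutely_continuous_AE[OF _ acP(1) pos]) (simp add: sets_mixture)
    have pos2: "AE x in P2. 0 < f x"
      by (rule absolutely_continuous_AE[OF _ acP(2) pos]) (simp add: sets_mixture sP)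
    have "(\<integral>\<^sup>+x. ennreal (- ln (f x)) \<partial>?P) < \<infinity>"
      using nn_integral_neg_log_ratio_finite[OF P.prob_space_axioms N.prob_space_axioms sPN ac]
      by (simp add: log_ratio_def f_def)
    then have neg: "(\<integral>\<^sup>+x. ennreal (- ln (f x)) \<partial>P1) < \<infinity>" "(\<integral>\<^sup>+x. ennreal (- ln (f x)) \<partial>P2) < \<infinity>"
      using 4 sP by (auto simp: nn_integral_mixture ennreal_mult_less_top ennreal_eq_0_iff)
    \<comment> \<open>The negative part of \<open>ln f\<close> is under control, so an upper bound on the extended integral gives integrability.\<close>
    have bound: "integrable Q (\<lambda>x. ln (f x)) \<and> (\<integral>x. ln (f x) \<partial>Q) \<le> l + a - 1"
      if "ereal_integral Q (\<lambda>x. ln (f x)) \<le> ereal l + ereal (a - 1)"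
        "(\<integral>\<^sup>+x. ennreal (- ln (f x)) \<partial>Q) < \<infinity>" and [measurable]: "f \<in> borel_measurable Q" for Q l a
    proof -
      have "(\<integral>\<^sup>+x. ennreal (ln (f x)) \<partial>Q) < \<infinity>"
        using that(1,2) unfolding ereal_integral_def
        by (cases "\<integral>\<^sup>+x. ennreal (ln (f x)) \<partial>Q"; cases "\<integral>\<^sup>+x. ennreal (- ln (f x)) \<partial>Q") auto
      then have "integrable Q (\<lambda>x. ln (f x))"
        using that(2) by (simp add: real_integrable_def less_top)
      then show ?thesis
        using that(1) by (simp add: ereal_integral_eq_integral)
    qed
    have b1: "integrable P1 (\<lambda>x. ln (f x)) \<and>
        (\<integral>x. ln (f x) \<partial>P1) \<le> (\<integral>x. log_ratio P1 N1 x \<partial>P1) + integral\<^sup>L N1 f - 1"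
      using entropy_variational[OF P(1) N(1) sets(1) fN1 f0 pos1] neg(1)
      unfolding KL1(3) by (intro bound) simp_all
    have b2: "integrable P2 (\<lambda>x. ln (f x)) \<and>
        (\<integral>x. ln (f x) \<partial>P2) \<le> (\<integral>x. log_ratio P2 N2 x \<partial>P2) + integral\<^sup>L N2 f - 1"
      using entropy_variational[OF P(2) N(2) _ fN2 f0 pos2] neg(2) sets
      unfolding KL2(3) by (intro bound) simp_all
    note I = integral_mixture[OF sP t conjunct1[OF b1] conjunct1[OF b2]]
    have "KL ?P ?N = ereal_integral ?P (\<lambda>x. ln (f x))"
      using KL_eq_ereal_integral[OF P.prob_space_axioms N.prob_space_axioms ac]
      by (simp add: log_ratio_def[abs_def] f_def)
    also have "\<dots> = ereal ((1 - t) * (\<integral>x. ln (f x) \<partial>P1) + t * (\<integral>x. ln (f x) \<partial>P2))"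
      by (simp add: ereal_integral_eq_integral I)
    also have "\<dots> \<le> ereal ((1 - t) * ((\<integral>x. log_ratio P1 N1 x \<partial>P1) + integral\<^sup>L N1 f - 1)
        + t * ((\<integral>x. log_ratio P2 N2 x \<partial>P2) + integral\<^sup>L N2 f - 1))"
      using b1 b2 t by (intro ereal_less_eq(3)[THEN iffD2] add_mono mult_left_mono) auto
    also have "\<dots> = ereal ((1 - t) * (\<integral>x. log_ratio P1 N1 x \<partial>P1) + t * (\<integral>x. log_ratio P2 N2 x \<partial>P2))"
      using f1 by (simp add: algebra_simps)
    also have "\<dots> = ereal (1 - t) * KL P1 N1 + ereal t * KL P2 N2"
      by (simp add: KL1(3) KL2(3))
    finally show ?thesis .
  qed
qed

lemma borel_probsD:
  assumes "P \<in> borel_probs"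
  shows "prob_space P" "sets P = sets borel" "space P = UNIV"
  using assms sets_eq_imp_space_eq[of P borel] by (auto simp: borel_probs_def)

lemma observation_borel_probs:
  assumes "Obs \<in> borel \<rightarrow>\<^sub>M prob_algebra borel" "P \<in> borel_probs"
  shows "P \<bind> Obs \<in> borel_probs"
  using prob_space_bind'[of P borel Obs borel] sets_bind'[of P borel Obs borel] assms
  by (simp add: borel_probs_def space_prob_algebra)

lemma mixture_observation:
  assumes Obs: "Obs \<in> borel \<rightarrow>\<^sub>M prob_algebra borel"
    and P: "P1 \<in> borel_probs" "P2 \<in> borel_probs" and t: "0 \<le> t" "t \<le> 1"
  shows "mixture t P1 P2 \<bind> Obs = mixture t (P1 \<bind> Obs) (P2 \<bind> Obs)"
proof (rule measure_eqI)
  note D = borel_probsD[OF P(1)] borel_probsD[OF P(2)]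
  have mix: "mixture t P1 P2 \<in> borel_probs"
    using D t by (simp add: borel_probs_def sets_mixture prob_space_mixture)
  have sets: "sets (P \<bind> Obs) = sets borel" if "P \<in> borel_probs" for P
    by (rule borel_probsD(2)[OF observation_borel_probs[OF Obs that]])
  show "sets (mixture t P1 P2 \<bind> Obs) = sets (mixture t (P1 \<bind> Obs) (P2 \<bind> Obs))"
    by (simp add: sets_mixture sets P mix)
  fix B assume "B \<in> sets (mixture t P1 P2 \<bind> Obs)"
  then have B: "B \<in> sets borel"
    by (simp add: sets mix)
  have "(\<lambda>x. emeasure (Obs x) B) \<in> borel_measurable P1"
    using measurable_compose[OF measurable_prob_algebraD[OF Obs] measurable_emeasure_subprob_algebra[OF B]]
    by (simp cong: measurable_cong_sets add: D)
  then show "emeasure (mixture t P1 P2 \<bind> Obs) B = emeasure (mixture t (P1 \<bind> Obs) (P2 \<bind> Obs)) B"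
    using B by (simp add: emeasure_observation[OF Obs] mix P nn_integral_mixture D emeasure_mixture sets)
qed

lemma rate_jointly_convex:
  assumes Obs: "Obs \<in> borel \<rightarrow>\<^sub>M prob_algebra borel"
    and P': "P1' \<in> borel_probs" "P2' \<in> borel_probs" and P: "P1 \<in> borel_probs" "P2 \<in> borel_probs"
    and t: "0 \<le> t" "t \<le> 1"
  shows "rate Obs (mixture t P1' P2') (mixture t P1 P2)
    \<le> ereal (1 - t) * rate Obs P1' P1 + ereal t * rate Obs P2' P2"
  unfolding rate_def mixture_observation[OF Obs P t]
  using P' observation_borel_probs[OF Obs] P t by (intro KL_mixture_le) (simp_all add: borel_probsD)

section \<open>Joint laws and their marginals\<close>

lemma density_marginals:
  assumes P: "sigma_finite_measure P" and M: "sigma_finite_measure M"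
    and Q: "prob_space Q" "sets Q = sets P" "absolutely_continuous P Q"
    and P': "prob_space P'" "sets P' = sets M" "absolutely_continuous M P'"
  shows "Q \<Otimes>\<^sub>M P' = density (P \<Otimes>\<^sub>M M) (\<lambda>z. RN_deriv P Q (fst z) * RN_deriv M P' (snd z))"
proof -
  interpret P: sigma_finite_measure P by fact
  interpret M: sigma_finite_measure M by fact
  interpret P': prob_space P' by fact
  have "Q \<Otimes>\<^sub>M P' = density P (RN_deriv P Q) \<Otimes>\<^sub>M density M (RN_deriv M P')"
    by (simp add: P.density_RN_deriv[OF Q(3,2)] M.density_RN_deriv[OF P'(3,2)])
  also have "\<dots> = density (P \<Otimes>\<^sub>M M) (\<lambda>(x, y). RN_deriv P Q x * RN_deriv M P' y)"
    by (intro pair_measure_density M)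
      (simp_all add: M.density_RN_deriv[OF P'(3,2)] P'.sigma_finite_measure_axioms)
  finally show ?thesis
    by (simp add: case_prod_beta')
qed

lemma AE_marginal_densities_pos_finite:
  assumes P: "sigma_finite_measure P" and M: "sigma_finite_measure M" and T: "prob_space T"
    and sets: "sets T = sets (P \<Otimes>\<^sub>M M)"
    and Q: "distr T P fst = Q" "absolutely_continuous P Q"
    and P': "distr T M snd = P'" "absolutely_continuous M P'"
  shows "AE z in T. 0 < RN_deriv P Q (fst z) \<and> RN_deriv P Q (fst z) < \<infinity>"
    and "AE z in T. 0 < RN_deriv M P' (snd z) \<and> RN_deriv M P' (snd z) < \<infinity>"
proof -
  note [measurable_cong] = sets
  interpret T: prob_space T by fact
  interpret Q: prob_space Q
    unfolding Q(1)[symmetric] by (rule T.prob_space_distr) simp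
  interpret P': prob_space P'
    unfolding P'(1)[symmetric] by (rule T.prob_space_distr) simp
  have "sets Q = sets P" "sets P' = sets M"
    by (simp_all flip: Q(1) P'(1))
  then have "AE x in Q. 0 < RN_deriv P Q x \<and> RN_deriv P Q x < \<infinity>"
    and "AE y in P'. 0 < RN_deriv M P' y \<and> RN_deriv M P' y < \<infinity>"
    using AE_RN_deriv_pos_finite[OF Q.finite_measure_axioms P _ Q(2)]
      AE_RN_deriv_pos_finite[OF P'.finite_measure_axioms M _ P'(2)] by blast+
  then show "AE z in T. 0 < RN_deriv P Q (fst z) \<and> RN_deriv P Q (fst z) < \<infinity>"
    and "AE z in T. 0 < RN_deriv M P' (snd z) \<and> RN_deriv M P' (snd z) < \<infinity>"
    using AE_distrD[of fst T P, unfolded Q(1)] AE_distrD[of snd T M, unfolded P'(1)]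
    by auto
qed

text \<open>
  The density of \<open>Q \<otimes> P'\<close> with respect to the base product is a product of functions of one coordinate each,
  and these functions are positive \<open>Q\<close>- and \<open>P'\<close>-almost everywhere, hence \<open>T\<close>-almost everywhere. So \<open>T\<close> cannot charge
  a set on which that density vanishes.
\<close>

lemma absolutely_continuous_marginals:
  assumes P: "sigma_finite_measure P" and M: "sigma_finite_measure M" and T: "prob_space T"
    and sets: "sets T = sets (P \<Otimes>\<^sub>M M)" and ac: "absolutely_continuous (P \<Otimes>\<^sub>M M) T"
    and Q: "distr T P fst = Q" "absolutely_continuous P Q"
    and P': "distr T M snd = P'" "absolutely_continuous M P'"
  shows "absolutely_continuous (Q \<Otimes>\<^sub>M P') T"
  unfolding absolutely_continuous_def
proof
  note [measurable_cong] = sets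
  interpret T: prob_space T by fact
  interpret Q: prob_space Q
    unfolding Q(1)[symmetric] by (rule T.prob_space_distr) simp
  interpret P': prob_space P'
    unfolding P'(1)[symmetric] by (rule T.prob_space_distr) simp
  have "sets Q = sets P" "sets P' = sets M"
    by (simp_all flip: Q(1) P'(1))
  then have R: "Q \<Otimes>\<^sub>M P' = density (P \<Otimes>\<^sub>M M) (\<lambda>z. RN_deriv P Q (fst z) * RN_deriv M P' (snd z))"
    by (intro density_marginals P M Q P' Q.prob_space_axioms P'.prob_space_axioms)
  fix E assume "E \<in> null_sets (Q \<Otimes>\<^sub>M P')"
  then have E: "E \<in> sets (P \<Otimes>\<^sub>M M)"
    "AE z in P \<Otimes>\<^sub>M M. z \<in> E \<longrightarrow> RN_deriv P Q (fst z) * RN_deriv M P' (snd z) = 0"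
    unfolding R by (auto simp: null_sets_density_iff)
  have "AE z in T. z \<notin> E"
    using absolutely_continuous_AE[OF sets ac E(2)]
      AE_marginal_densities_pos_finite[OF P M T sets Q P']
    by eventually_elim auto
  then show "E \<in> null_sets T"
    using E(1) sets by (subst AE_iff_null_sets) auto
qed

text \<open>
  The chain rule for densities: multiplying the densities of \<open>T\<close> with respect to \<open>Q \<otimes> P'\<close>, of \<open>Q\<close> with respect to
  \<open>P\<close> and of \<open>P'\<close> with respect to \<open>M\<close> gives the density of \<open>T\<close> with respect to \<open>P \<otimes> M\<close>, and dividing by \<open>w\<close> the one
  with respect to \<open>J\<close>. All factors are positive and finite \<open>T\<close>-almost everywhere, so the
  logarithm of the product splits.
\<close>

lemma log_ratio_chain:
  assumes P: "sigma_finite_measure P" and M: "sigma_finite_measure M" and T: "prob_space T"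
    and sets: "sets T = sets (P \<Otimes>\<^sub>M M)"
    and w: "w \<in> borel_measurable (P \<Otimes>\<^sub>M M)" "\<And>z. 0 < (w z :: real)"
    and Q: "distr T P fst = Q" "absolutely_continuous P Q"
    and P': "distr T M snd = P'" "absolutely_continuous M P'"
    and acT: "absolutely_continuous (Q \<Otimes>\<^sub>M P') T"
    and J: "J = density (P \<Otimes>\<^sub>M M) (\<lambda>z. ennreal (w z))"
  shows "absolutely_continuous J T"
    and "AE z in T. log_ratio T J z =
      log_ratio T (Q \<Otimes>\<^sub>M P') z + log_ratio Q P (fst z) + log_ratio P' M (snd z) - ln (w z)"
proof -
  note [measurable_cong] = sets
  note [measurable] = w(1)
  interpret T: prob_space T by fact
  interpret P: sigma_finite_measure P by fact
  interpret M: sigma_finite_measure M by fact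
  interpret PM: pair_sigma_finite P M ..
  interpret Q: prob_space Q
    unfolding Q(1)[symmetric] by (rule T.prob_space_distr) simp
  interpret P': prob_space P'
    unfolding P'(1)[symmetric] by (rule T.prob_space_distr) simp
  interpret R: pair_prob_space Q P' ..
  have setsQP: "sets Q = sets P" "sets P' = sets M"
    by (simp_all flip: Q(1) P'(1))
  then have sets_R: "sets (Q \<Otimes>\<^sub>M P') = sets (P \<Otimes>\<^sub>M M)"
    by (rule sets_pair_measure_cong)
  define q p r where qpr: "q = RN_deriv P Q" "p = RN_deriv M P'" "r = RN_deriv (Q \<Otimes>\<^sub>M P') T"
  have [measurable]: "q \<in> borel_measurable P" "p \<in> borel_measurable M" "r \<in> borel_measurable (P \<Otimes>\<^sub>M M)"
    unfolding qpr using borel_measurable_RN_deriv[of "Q \<Otimes>\<^sub>M P'" T] sets_R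
    by (auto cong: measurable_cong_sets)
  have R: "Q \<Otimes>\<^sub>M P' = density (P \<Otimes>\<^sub>M M) (\<lambda>z. q (fst z) * p (snd z))"
    unfolding qpr by (intro density_marginals P M Q P' Q.prob_space_axioms P'.prob_space_axioms setsQP)
  have "sets T = sets (Q \<Otimes>\<^sub>M P')"
    using sets sets_R by simp
  note T_r = R.P.density_RN_deriv[OF acT this, folded qpr]
  define g where "g = (\<lambda>z. q (fst z) * p (snd z) * r z * ennreal (1 / w z))"
  have [measurable]: "g \<in> borel_measurable (P \<Otimes>\<^sub>M M)"
    unfolding g_def by measurable
  have "T = density (P \<Otimes>\<^sub>M M) (\<lambda>z. q (fst z) * p (snd z) * r z)"
    unfolding T_r[symmetric] R by (rule density_density_eq) measurable
  also have "\<dots> = density (P \<Otimes>\<^sub>M M) (\<lambda>z. ennreal (w z) * g z)"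
  proof (rule arg_cong[where f = "density (P \<Otimes>\<^sub>M M)"], rule ext)
    fix z
    have "ennreal (w z) * ennreal (1 / w z) = 1"
      using w(2)[of z] by (simp flip: ennreal_mult)
    then show "q (fst z) * p (snd z) * r z = ennreal (w z) * g z"
      unfolding g_def by (metis mult.commute mult.left_commute mult.right_neutral)
  qed
  also have "\<dots> = density J g"
    unfolding J by (subst density_density_eq) auto
  finally have T_J: "density J g = T" ..
  have gJ: "g \<in> borel_measurable J"
    by (simp add: J)
  then show ac: "absolutely_continuous J T"
    unfolding T_J[symmetric] by (rule absolutely_continuousI_density)
  have "sigma_finite_measure J"
    unfolding J by (subst PM.P.sigma_finite_iff_density_finite) auto
  then interpret J: sigma_finite_measure J .
  have sets_J: "sets T = sets J"
    by (simp add: J sets)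
  have g: "AE z in T. g z = RN_deriv J T z"
    by (rule absolutely_continuous_AE[OF sets_J ac J.RN_deriv_unique[OF gJ T_J]])
  have r: "AE z in T. 0 < r z \<and> r z < \<infinity>"
    unfolding qpr
    by (rule AE_RN_deriv_pos_finite[OF T.finite_measure_axioms R.P.sigma_finite_measure_axioms _ acT]) fact
  show "AE z in T. log_ratio T J z =
      log_ratio T (Q \<Otimes>\<^sub>M P') z + log_ratio Q P (fst z) + log_ratio P' M (snd z) - ln (w z)"
    using AE_marginal_densities_pos_finite[OF P M T sets Q P', folded qpr] g r
  proof eventually_elim
    case (elim z)
    then have "0 < enn2real (q (fst z))" "0 < enn2real (p (snd z))" "0 < enn2real (r z)"
      by (auto simp: enn2real_positive_iff)
    then show ?case
      using w(2)[of z] elim(3)[symmetric]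
      by (simp add: log_ratio_def g_def enn2real_mult ln_mult ln_div flip: qpr)
  qed
qed

text \<open>
  An everywhere positive Radon-Nikodym derivative makes the base measure equivalent to a probability measure,
  hence \<open>\<sigma>\<close>-finite. \<open>RN_deriv\<close> is zero when no density exists; positivity rules this case out, because
  \<open>M\<close> is not the zero measure.
\<close>

lemma density_base_measure:
  assumes N: "prob_space N" "sets N = sets M" and ac: "absolutely_continuous M N"
    and f: "f \<in> borel_measurable M" "\<And>x. 0 < (f x :: real)"
    and RN: "AE x in M. RN_deriv M N x = ennreal (f x)"
  shows "density M (\<lambda>x. ennreal (f x)) = N" "sigma_finite_measure M"
proof -
  interpret N: prob_space N by fact
  have space: "space N = space M"
    by (rule sets_eq_imp_space_eq[OF N(2)])
  have "\<exists>g. g \<in> borel_measurable M \<and> density M g = N"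
  proof (rule ccontr)
    assume "\<not> ?thesis"
    then have "RN_deriv M N x = 0" for x
      unfolding RN_deriv_def by (simp only: if_False)
    then have "RN_deriv M N x \<noteq> ennreal (f x)" for x
      using f(2)[of x] by (metis ennreal_less_zero_iff less_irrefl)
    with RN have "AE x in M. False"
      by simp
    then have "space M \<in> null_sets M"
      by (subst AE_iff_null_sets) (auto elim: eventually_mono)
    then have "space M \<in> null_sets N"
      using ac by (auto simp: absolutely_continuous_def)
    then show False
      using N.emeasure_space_1 by (simp add: space null_sets_def)
  qed
  then have "density M (RN_deriv M N) = N"
    using RN_derivI by metis
  moreover have "density M (RN_deriv M N) = density M (\<lambda>x. ennreal (f x))"
    using f RN by (intro density_cong) auto
  ultimately show N_f: "density M (\<lambda>x. ennreal (f x)) = N"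
    by simp
  have "density N (\<lambda>x. ennreal (1 / f x)) = density M (\<lambda>x. ennreal (f x) * ennreal (1 / f x))"
    unfolding N_f[symmetric] using f(1) by (intro density_density_eq) auto
  also have "(\<lambda>x. ennreal (f x) * ennreal (1 / f x)) = (\<lambda>_. 1)"
    using f(2) by (auto simp: fun_eq_iff less_imp_neq[symmetric] less_imp_le simp flip: ennreal_mult)
  finally have M: "density N (\<lambda>x. ennreal (1 / f x)) = M"
    by (simp add: density_1)
  have "(\<lambda>x. ennreal (1 / f x)) \<in> borel_measurable N"
    using f(1) by (simp flip: N_f)
  then show "sigma_finite_measure M"
    by (subst M[symmetric], subst N.sigma_finite_iff_density_finite) auto
qed

section \<open>The transport objective\<close>

lemma sets_borel_prod:
  "sets (borel \<Otimes>\<^sub>M borel) =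
    sets (borel :: ('a::second_countable_topology \<times> 'b::second_countable_topology) measure)"
  by (subst borel_prod) (rule refl)

lemma measurable_fst_borel:
  "fst \<in> (borel :: ('a::second_countable_topology \<times> 'b::second_countable_topology) measure) \<rightarrow>\<^sub>M borel"
  by (subst borel_prod[symmetric]) (rule measurable_fst)

lemma measurable_snd_borel:
  "snd \<in> (borel :: ('a::second_countable_topology \<times> 'b::second_countable_topology) measure) \<rightarrow>\<^sub>M borel"
  by (subst borel_prod[symmetric]) (rule measurable_snd)

lemma couplingsD:
  assumes "T \<in> couplings P' Q"
  shows "prob_space T" "sets T = sets borel" "distr T borel fst = Q" "distr T borel snd = P'"
  using assms by (auto simp: couplings_def borel_probs_def)

text \<open>
  When cost and divergence can be added, their sum equals the single integral used in the
  remaining cases, so only the distinction between absolutely continuous and other couplings remains.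
\<close>

lemma eot_objective_eq:
  fixes d :: "'a::polish_space \<times> 'b::polish_space \<Rightarrow> real"
  assumes T: "T \<in> couplings P' Q" and d: "d \<in> borel_measurable borel"
  shows "eot_objective d T =
    (if absolutely_continuous (Q \<Otimes>\<^sub>M P') T
     then ereal_integral T (\<lambda>z. d z + log_ratio T (Q \<Otimes>\<^sub>M P') z) else \<infinity>)"
proof -
  let ?R = "Q \<Otimes>\<^sub>M P'"
  note T = couplingsD[OF T]
  interpret T: prob_space T by fact
  have "fst \<in> T \<rightarrow>\<^sub>M borel" "snd \<in> T \<rightarrow>\<^sub>M borel"
    using measurable_fst_borel measurable_snd_borel by (simp_all cong: measurable_cong_sets add: T(2))
  then interpret Q: prob_space Q + P': prob_space P'
    unfolding T(3,4)[symmetric] by (simp_all add: T.prob_space_distr)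
  interpret R: pair_prob_space Q P' ..
  have sets_R: "sets ?R = sets borel"
    using sets_pair_measure_cong[of Q borel P' borel] by (simp add: sets_borel_prod flip: T(3,4))
  have sets_TR: "sets T = sets ?R"
    using T(2) sets_R by simp
  show ?thesis
  proof (cases "absolutely_continuous ?R T")
    case True
    have d_T: "d \<in> borel_measurable T"
      using d by (simp cong: measurable_cong_sets add: T(2))
    have l_T: "log_ratio T ?R \<in> borel_measurable T"
      using borel_measurable_log_ratio[of T ?R] by (simp cong: measurable_cong_sets add: sets_TR)
    have "quasi_integrable T (log_ratio T ?R)"
      using nn_integral_neg_log_ratio_finite[OF T(1) R.prob_space_axioms sets_TR True]
      by (simp add: quasi_integrable_def)
    then have "ereal_integral T (\<lambda>z. d z + log_ratio T ?R z) = ereal_integral T d + KL T ?R"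
      if "quasi_integrable T d" "sum_defined (ereal_integral T d) (KL T ?R)"
      using that ereal_integral_add[OF d_T l_T]
      unfolding KL_eq_ereal_integral[OF T(1) R.prob_space_axioms True] by blast
    with True show ?thesis
      unfolding eot_objective_def T(3,4) Let_def by auto
  next
    case False
    then show ?thesis
      unfolding eot_objective_def T(3,4) Let_def by (simp add: KL_def)
  qed
qed

section \<open>Decomposition of the rate function\<close>

text \<open>
  The densities enter as equations between measures, which leave no null sets to track in \<open>\<xi>\<close>; \<open>\<sigma>\<close>-finiteness
  of the base measure gives Fubini's theorem for its product with \<open>P\<close>.
\<close>

locale gibbs_kernel =
  fixes Obs :: "'a::polish_space \<Rightarrow> 'b::polish_space measure"
    and m' :: "'b measure"
    and d :: "'a \<times> 'b \<Rightarrow> real"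
  assumes Obs [measurable]: "Obs \<in> borel \<rightarrow>\<^sub>M prob_algebra borel"
    and sets_base: "sets m' = sets borel"
    and sigma_finite_base: "sigma_finite_measure m'"
    and d [measurable]: "d \<in> borel_measurable borel"
    and density_Obs: "\<And>\<xi>. density m' (\<lambda>\<xi>'. ennreal (exp (- d (\<xi>, \<xi>')))) = Obs \<xi>"
begin

sublocale base: sigma_finite_measure m'
  by (rule sigma_finite_base)

definition joint :: "'a measure \<Rightarrow> ('a \<times> 'b) measure" where
  "joint P = density (P \<Otimes>\<^sub>M m') (\<lambda>z. ennreal (exp (- d z)))"

lemma sets_pair_base:
  fixes P :: "'a measure"
  assumes "P \<in> borel_probs"
  shows "sets (P \<Otimes>\<^sub>M m') = sets borel"
  by (rule trans[OF sets_pair_measure_cong[OF borel_probsD(2)[OF assms] sets_base] sets_borel_prod])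

lemma sets_joint: "P \<in> borel_probs \<Longrightarrow> sets (joint P) = sets borel"
  by (simp add: joint_def sets_pair_base)

lemma emeasure_joint:
  assumes P: "P \<in> borel_probs" and A: "A \<in> sets borel" and B: "B \<in> sets borel"
  shows "emeasure (joint P) (A \<times> B) = (\<integral>\<^sup>+x. emeasure (Obs x) B * indicator A x \<partial>P)"
proof -
  note [measurable_cong] = borel_probsD(2)[OF P] sets_base
  have [measurable]: "A \<in> sets P" "B \<in> sets m'"
    using A B borel_probsD(2)[OF P] sets_base by simp_all
  have [measurable]: "d \<in> borel_measurable (P \<Otimes>\<^sub>M m')"
    using d by (simp cong: measurable_cong_sets add: sets_pair_base[OF P])
  have "emeasure (joint P) (A \<times> B) =
      (\<integral>\<^sup>+z. ennreal (exp (- d z)) * indicator (A \<times> B) z \<partial>(P \<Otimes>\<^sub>M m'))"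
    unfolding joint_def by (intro emeasure_density) auto
  also have "\<dots> = (\<integral>\<^sup>+x. \<integral>\<^sup>+y. ennreal (exp (- d (x, y))) * indicator (A \<times> B) (x, y) \<partial>m' \<partial>P)"
    by (intro base.nn_integral_fst[symmetric]) auto
  also have "\<dots> = (\<integral>\<^sup>+x. emeasure (Obs x) B * indicator A x \<partial>P)"
  proof (intro nn_integral_cong)
    fix x
    have [measurable]: "(\<lambda>y. d (x, y)) \<in> borel_measurable m'"
      by (rule measurable_compose[OF _ d]) (simp cong: measurable_cong_sets flip: sets_borel_prod)
    have "(\<integral>\<^sup>+y. ennreal (exp (- d (x, y))) * indicator (A \<times> B) (x, y) \<partial>m') =
      (\<integral>\<^sup>+y. ennreal (exp (- d (x, y))) * indicator B y * indicator A x \<partial>m')"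
      by (intro nn_integral_cong) (auto split: split_indicator)
    also have "\<dots> = (\<integral>\<^sup>+y. ennreal (exp (- d (x, y))) * indicator B y \<partial>m') * indicator A x"
      by (intro nn_integral_multc) auto
    also have "(\<integral>\<^sup>+y. ennreal (exp (- d (x, y))) * indicator B y \<partial>m') = emeasure (Obs x) B"
      unfolding density_Obs[symmetric] by (intro emeasure_density[symmetric]) auto
    finally show "(\<integral>\<^sup>+y. ennreal (exp (- d (x, y))) * indicator (A \<times> B) (x, y) \<partial>m') =
        emeasure (Obs x) B * indicator A x" .
  qed
  finally show ?thesis .
qed

lemma emeasure_Obs_UNIV: "emeasure (Obs x) UNIV = 1"
proof -
  have "Obs x \<in> space (prob_algebra borel)"
    using measurable_space[OF Obs] by simp
  then have "prob_space (Obs x)" "sets (Obs x) = sets borel"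
    by (auto simp: space_prob_algebra)
  then show ?thesis
    using prob_space.emeasure_space_1[of "Obs x"] sets_eq_imp_space_eq[of "Obs x" borel] by simp
qed

lemma distr_joint:
  assumes P: "P \<in> borel_probs"
  shows "distr (joint P) borel fst = P" "distr (joint P) borel snd = P \<bind> Obs"
proof -
  have sJ: "sets (joint P) = sets (borel \<Otimes>\<^sub>M borel)"
    by (simp add: sets_joint[OF P] sets_borel_prod)
  note [measurable_cong] = sJ
  have spJ: "space (joint P) = UNIV"
    using sets_eq_imp_space_eq[OF sJ] by (simp add: space_pair_measure)
  show "distr (joint P) borel fst = P"
  proof (rule measure_eqI)
    fix A assume "A \<in> sets (distr (joint P) borel fst)"
    then have A: "A \<in> sets borel" by simp
    have "emeasure (distr (joint P) borel fst) A = emeasure (joint P) (A \<times> UNIV)"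
      using A by (subst emeasure_distr) (auto simp: spJ intro!: arg_cong[where f = "emeasure _"])
    also have "\<dots> = emeasure P A"
      using A borel_probsD(2)[OF P] by (simp add: emeasure_joint[OF P] emeasure_Obs_UNIV)
    finally show "emeasure (distr (joint P) borel fst) A = emeasure P A" .
  qed (simp add: borel_probsD[OF P])
  show "distr (joint P) borel snd = P \<bind> Obs"
  proof (rule measure_eqI)
    fix B assume "B \<in> sets (distr (joint P) borel snd)"
    then have B: "B \<in> sets borel" by simp
    have "emeasure (distr (joint P) borel snd) B = emeasure (joint P) (UNIV \<times> B)"
      using B by (subst emeasure_distr) (auto simp: spJ intro!: arg_cong[where f = "emeasure _"])
    also have "\<dots> = emeasure (P \<bind> Obs) B"
      using B by (simp add: emeasure_joint[OF P] emeasure_observation[OF Obs P])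
    finally show "emeasure (distr (joint P) borel snd) B = emeasure (P \<bind> Obs) B" .
  qed (simp add: borel_probsD(2)[OF observation_borel_probs[OF Obs P]])
qed

lemma prob_space_joint: "P \<in> borel_probs \<Longrightarrow> prob_space (joint P)"
proof
  assume P: "P \<in> borel_probs"
  have "space (joint P) = UNIV \<times> UNIV"
    using sets_eq_imp_space_eq[OF sets_joint[OF P]] by simp
  then show "emeasure (joint P) (space (joint P)) = 1"
    using prob_space.emeasure_space_1[OF borel_probsD(1)[OF P]]
    by (simp add: emeasure_joint[OF P] emeasure_Obs_UNIV borel_probsD(3)[OF P] del: UNIV_Times_UNIV)
qed

lemma rate_le_KL_joint:
  assumes P: "P \<in> borel_probs" and T: "T \<in> couplings P' Q"
  shows "rate Obs P' P \<le> KL T (joint P)"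
proof -
  have "KL (distr T borel snd) (distr (joint P) borel snd) \<le> KL T (joint P)"
    using couplingsD[OF T] by (intro KL_distr_le prob_space_joint P)
      (simp_all cong: measurable_cong_sets add: sets_joint[OF P] measurable_snd_borel)
  then show ?thesis
    by (simp add: rate_def couplingsD[OF T] distr_joint[OF P])
qed

text \<open>
  The chain rule for densities with \<open>w = exp (- d)\<close>, integrated over \<open>T\<close>. The integral of \<open>log dQ/dP\<close> is finite, and that of
  \<open>log dT/dJ\<close> exceeds \<open>-\<infinity>\<close>, so the only possible conflict is \<open>\<infinity> - \<infinity>\<close> between \<open>KL(T, J)\<close> and \<open>KL(P', m')\<close>.
\<close>

lemma eot_objective_eq_KL_joint:
  assumes P: "P \<in> borel_probs" and T: "T \<in> couplings P' Q"
    and KL_Q: "KL Q P < \<infinity>"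
    and P': "absolutely_continuous m' P'" "quasi_integrable P' (log_ratio P' m')"
    and def: "sum_defined (KL T (joint P)) (- rel_entropy P' m')"
    and ac: "absolutely_continuous (Q \<Otimes>\<^sub>M P') T"
  shows "eot_objective d T = KL T (joint P) + - KL Q P + - rel_entropy P' m'"
proof -
  let ?R = "Q \<Otimes>\<^sub>M P'"
  note D = couplingsD[OF T] and PD = borel_probsD[OF P]
  interpret T: prob_space T by fact
  interpret P: prob_space P by fact
  have sT: "sets T = sets (P \<Otimes>\<^sub>M m')"
    by (simp add: D sets_pair_base[OF P])
  note [measurable_cong] = sT PD(2) sets_base
  have Q: "distr T P fst = Q" and P'_eq: "distr T m' snd = P'"
    unfolding D(3,4)[symmetric] by (auto intro!: distr_cong simp: PD sets_base)
  interpret Q: prob_space Q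
    unfolding Q[symmetric] by (rule T.prob_space_distr) simp
  interpret P': prob_space P'
    unfolding P'_eq[symmetric] by (rule T.prob_space_distr) simp
  have sQ: "sets Q = sets P" and sP': "sets P' = sets m'"
    by (simp_all flip: Q P'_eq)
  note KQ = KL_finiteD[OF Q.prob_space_axioms P.prob_space_axioms sQ KL_Q]
  have d_PM [measurable]: "d \<in> borel_measurable (P \<Otimes>\<^sub>M m')"
    using d by (simp cong: measurable_cong_sets add: sets_pair_base[OF P])
  have w: "(\<lambda>z. exp (- d z)) \<in> borel_measurable (P \<Otimes>\<^sub>M m')" "\<And>z. 0 < exp (- d z)"
    by simp_all
  note chain = log_ratio_chain[OF P.sigma_finite_measure_axioms sigma_finite_base D(1) sT w
      Q KQ(1) P'_eq P'(1) ac joint_def]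
  have sJ: "sets T = sets (joint P)"
    by (simp add: D sets_joint[OF P])
  have lJ [measurable]: "log_ratio T (joint P) \<in> borel_measurable T"
    using borel_measurable_log_ratio[of T "joint P"] by (simp cong: measurable_cong_sets add: sJ)
  have lQ: "log_ratio Q P \<in> borel_measurable P" and lP': "log_ratio P' m' \<in> borel_measurable m'"
    by (rule borel_measurable_log_ratio)+
  note [measurable] = lQ lP'
  let ?lQ = "\<lambda>z. log_ratio Q P (fst z)" and ?lP = "\<lambda>z. log_ratio P' m' (snd z)"
  have IQ: "ereal_integral T ?lQ = KL Q P" "integrable T ?lQ"
  proof -
    show int: "integrable T ?lQ"
      using KQ(2) integrable_distr_eq[of fst T P "log_ratio Q P"] by (simp add: Q)
    have "integral\<^sup>L T ?lQ = integral\<^sup>L Q (log_ratio Q P)"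
      using integral_distr[of fst T P "log_ratio Q P"] by (simp add: Q)
    with int show "ereal_integral T ?lQ = KL Q P"
      unfolding KQ(3) by (simp add: ereal_integral_eq_integral)
  qed
  have nnP: "(\<integral>\<^sup>+z. ennreal (f (snd z)) \<partial>T) = (\<integral>\<^sup>+y. ennreal (f y) \<partial>P')"
    if "f \<in> borel_measurable m'" for f
    unfolding P'_eq[symmetric] using that by (intro nn_integral_distr[symmetric]) auto
  have IP: "ereal_integral T ?lP = rel_entropy P' m'" "quasi_integrable T ?lP"
    using P' nnP[of "log_ratio P' m'"] nnP[of "\<lambda>y. - log_ratio P' m' y"]
    by (simp_all add: rel_entropy_def ereal_integral_def quasi_integrable_def)
  have IJ: "ereal_integral T (log_ratio T (joint P)) = KL T (joint P)"
      "quasi_integrable T (log_ratio T (joint P))"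
    using KL_eq_ereal_integral[OF D(1) prob_space_joint[OF P] chain(1)]
      nn_integral_neg_log_ratio_finite[OF D(1) prob_space_joint[OF P] sJ chain(1)]
    by (simp_all add: quasi_integrable_def)
  have minus_IP: "ereal_integral T (\<lambda>z. - ?lP z) = - rel_entropy P' m'" "quasi_integrable T (\<lambda>z. - ?lP z)"
    using IP by (simp_all add: ereal_integral_uminus quasi_integrable_uminus)
  have minus_IQ: "ereal_integral T (\<lambda>z. - ?lQ z) = - KL Q P" "quasi_integrable T (\<lambda>z. - ?lQ z)"
    using IQ integrable_imp_quasi_integrable[of T ?lQ]
    by (simp_all add: ereal_integral_uminus quasi_integrable_uminus)
  have sum_JP: "quasi_integrable T (\<lambda>z. log_ratio T (joint P) z + - ?lP z)"
    "ereal_integral T (\<lambda>z. log_ratio T (joint P) z + - ?lP z) = KL T (joint P) + - rel_entropy P' m'"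
    using ereal_integral_add[OF lJ _ IJ(2) minus_IP(2)] def unfolding IJ(1) minus_IP(1) by simp_all
  have "eot_objective d T = ereal_integral T (\<lambda>z. d z + log_ratio T ?R z)"
    using ac by (simp add: eot_objective_eq[OF T d])
  also have "\<dots> = ereal_integral T (\<lambda>z. (log_ratio T (joint P) z + - ?lP z) + - ?lQ z)"
    using chain(2) by (intro ereal_integral_cong_AE, eventually_elim) simp
  also have "\<dots> = (KL T (joint P) + - rel_entropy P' m') + - KL Q P"
    using ereal_integral_add(2)[OF _ _ sum_JP(1) minus_IQ(2)] KQ(3)
    unfolding sum_JP(2) minus_IQ(1) by (simp add: sum_defined_def)
  also have "\<dots> = KL T (joint P) + - KL Q P + - rel_entropy P' m'"
    by (simp add: ac_simps)
  finally show ?thesis .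
qed

text \<open>
  The minimizer: \<open>T(d\<xi>, d\<xi>') = r(\<xi>') J(d\<xi>, d\<xi>')\<close> with \<open>r = dP'/d(O \<star> P)\<close>. Its second marginal is \<open>P'\<close>. Its first
  marginal \<open>Q\<close> averages, over \<open>P'\<close>, the posterior laws of the noiseless observation given the noisy one.
\<close>

lemma tilted_coupling:
  assumes P: "P \<in> borel_probs" and P': "P' \<in> borel_probs" "absolutely_continuous m' P'"
    and fin: "rate Obs P' P < \<infinity>"
  obtains Q T where "Q \<in> borel_probs" "T \<in> couplings P' Q" "KL Q P < \<infinity>"
    "KL T (joint P) = rate Obs P' P" "absolutely_continuous (Q \<Otimes>\<^sub>M P') T"
proof -
  let ?N = "P \<bind> Obs" and ?J = "joint P"
  note PD = borel_probsD[OF P] and P'D = borel_probsD[OF P'(1)]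
  note ND = borel_probsD[OF observation_borel_probs[OF Obs P]]
  interpret P: prob_space P by fact
  interpret P': prob_space P' by fact
  interpret N: prob_space ?N by (rule ND)
  interpret J: prob_space ?J by (rule prob_space_joint[OF P])
  have sJ: "sets ?J = sets (P \<Otimes>\<^sub>M m')"
    by (simp add: sets_joint[OF P] sets_pair_base[OF P])
  note [measurable_cong] = sJ PD(2) sets_base ND(2)
  have ac: "absolutely_continuous ?N P'"
    using KL_finiteD(1)[OF P'D(1) ND(1)] fin by (simp add: rate_def P'D ND)
  define r where "r = RN_deriv ?N P'"
  have [measurable]: "r \<in> borel_measurable ?N"
    unfolding r_def by measurable
  have N_r: "density ?N r = P'"
    unfolding r_def by (rule N.density_RN_deriv[OF ac]) (simp add: P'D ND)
  define T where "T = density ?J (\<lambda>z. r (snd z))"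
  define Q where "Q = distr T borel fst"
  have sT: "sets T = sets ?J"
    by (simp add: T_def)
  have fst_T: "fst \<in> T \<rightarrow>\<^sub>M borel" and snd_T: "snd \<in> T \<rightarrow>\<^sub>M borel" and snd_J: "snd \<in> ?J \<rightarrow>\<^sub>M borel"
    using measurable_fst_borel measurable_snd_borel
    by (simp_all cong: measurable_cong_sets add: sT sets_joint[OF P])
  have "density (distr ?J borel snd) r = distr T borel snd"
    unfolding T_def by (rule density_distr) (use snd_J in \<open>simp_all cong: measurable_cong_sets\<close>)
  then have T_snd: "distr T borel snd = P'"
    by (simp add: distr_joint[OF P] N_r)
  have "prob_space T"
    by (rule prob_space_distrD[OF snd_T]) (simp add: T_snd P'.prob_space_axioms)
  then interpret T: prob_space T .
  interpret Q: prob_space Q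
    unfolding Q_def by (rule T.prob_space_distr[OF fst_T])
  have Q: "Q \<in> borel_probs"
    by (simp add: borel_probs_def Q.prob_space_axioms) (simp add: Q_def)
  have T: "T \<in> couplings P' Q"
    using T_snd by (simp add: couplings_def borel_probs_def T.prob_space_axioms Q_def sT sets_joint[OF P])
  have acJ: "absolutely_continuous ?J T"
    unfolding T_def by (rule absolutely_continuousI_density) measurable
  have "AE z in ?J. r (snd z) = RN_deriv ?J T z"
    by (rule J.RN_deriv_unique) (simp_all add: T_def)
  then have r: "AE z in T. r (snd z) = RN_deriv ?J T z"
    by (rule absolutely_continuous_AE[OF sT acJ])
  have "KL T ?J = ereal_integral T (log_ratio T ?J)"
    by (rule KL_eq_ereal_integral[OF T.prob_space_axioms J.prob_space_axioms acJ])
  also have "\<dots> = ereal_integral T (\<lambda>z. log_ratio P' ?N (snd z))"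
    using r by (intro ereal_integral_cong_AE, eventually_elim) (simp add: log_ratio_def r_def)
  also have "\<dots> = ereal_integral P' (log_ratio P' ?N)"
    unfolding ereal_integral_def T_snd[symmetric]
    by (simp add: nn_integral_distr[OF snd_T] borel_measurable_log_ratio)
  also have "\<dots> = rate Obs P' P"
    using KL_eq_ereal_integral[OF P'D(1) ND(1) ac] by (simp add: rate_def)
  finally have KL_T: "KL T ?J = rate Obs P' P" .
  have "KL Q (distr ?J borel fst) \<le> KL T ?J"
    unfolding Q_def by (intro KL_distr_le T.prob_space_axioms J.prob_space_axioms sT) simp
  then have KL_Q: "KL Q P < \<infinity>"
    unfolding distr_joint[OF P] KL_T using fin by (rule le_less_trans)
  have "absolutely_continuous (P \<Otimes>\<^sub>M m') ?J"
    unfolding joint_def by (rule absolutely_continuousI_density)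
      (use d in \<open>simp cong: measurable_cong_sets add: sets_pair_base[OF P]\<close>)
  then have acT: "absolutely_continuous (P \<Otimes>\<^sub>M m') T"
    using acJ by (auto simp: absolutely_continuous_def)
  have "absolutely_continuous (Q \<Otimes>\<^sub>M P') T"
  proof (rule absolutely_continuous_marginals[OF P.sigma_finite_measure_axioms sigma_finite_base
        T.prob_space_axioms _ acT])
    show "sets T = sets (P \<Otimes>\<^sub>M m')"
      by (simp add: sT sJ)
    show "distr T P fst = Q" "distr T m' snd = P'"
      unfolding Q_def T_snd[symmetric] by (auto intro!: distr_cong simp: PD sets_base)
    show "absolutely_continuous P Q"
      by (rule KL_finiteD(1)[OF Q.prob_space_axioms P.prob_space_axioms _ KL_Q]) (simp add: Q_def PD)
  qed (rule P')
  then show ?thesis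
    using that Q T KL_Q KL_T by blast
qed

lemma observation_absolutely_continuous:
  assumes P: "P \<in> borel_probs"
  shows "absolutely_continuous m' (P \<bind> Obs)"
  unfolding absolutely_continuous_def
proof
  fix B assume B: "B \<in> null_sets m'"
  then have "B \<in> sets borel"
    by (auto simp: sets_base)
  have "emeasure (Obs x) B = 0" for x
  proof -
    have "(\<lambda>y. d (x, y)) \<in> borel_measurable borel"
      by (rule measurable_compose[OF _ d]) (simp cong: measurable_cong_sets flip: sets_borel_prod)
    then have "absolutely_continuous m' (Obs x)"
      unfolding density_Obs[symmetric]
      by (intro absolutely_continuousI_density) (simp cong: measurable_cong_sets add: sets_base)
    with B show ?thesis
      by (auto simp: absolutely_continuous_def)
  qed
  then show "B \<in> null_sets (P \<bind> Obs)"
    using \<open>B \<in> sets borel\<close> borel_probsD(2)[OF observation_borel_probs[OF Obs P]]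
    by (simp add: null_sets_def emeasure_observation[OF Obs P])
qed

text \<open>
  When \<open>KL(P', m')\<close> is finite, an absolutely continuous coupling \<open>T\<close> contributes \<open>KL(T, J)\<close> to the right-hand side,
  where \<open>J\<close> is the joint law. The lower bound follows by projecting \<open>T\<close> to the second coordinate, the upper
  bound from the tilted coupling.
\<close>

theorem rate_decomposition:
  assumes P': "P' \<in> borel_probs" and P: "P \<in> borel_probs"
    and H_defined: "rel_entropy_defined P' m'"
    and sum: "\<And>Q. Q \<in> borel_probs \<Longrightarrow> KL Q P < \<infinity> \<Longrightarrow> sum_defined (rel_entropy P' m') (eot d P' Q)"
  shows "rate Obs P' P = (INF Q\<in>borel_probs. KL Q P + rel_entropy P' m' + eot d P' Q)"
proof -
  have INF_infinite: "(INF Q\<in>borel_probs. KL Q P + rel_entropy P' m' + eot d P' Q) = \<infinity>"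
    if "rel_entropy P' m' = \<infinity>"
  proof (rule antisym)
    show "\<infinity> \<le> (INF Q\<in>borel_probs. KL Q P + rel_entropy P' m' + eot d P' Q)"
      using that by (intro INF_greatest) simp
  qed simp
  show ?thesis
  proof (cases "absolutely_continuous m' P'")
    case False
    then have "\<not> absolutely_continuous (P \<bind> Obs) P'"
      using observation_absolutely_continuous[OF P] by (auto simp: absolutely_continuous_def)
    then have "rate Obs P' P = \<infinity>"
      by (simp add: rate_def KL_def)
    moreover have "rel_entropy P' m' = \<infinity>"
      using False by (simp add: rel_entropy_def)
    ultimately show ?thesis
      using INF_infinite by simp
  next
    case ac: True
    let ?H = "rel_entropy P' m'"
    have qi: "quasi_integrable P' (log_ratio P' m')"
      using H_defined ac by (simp add: rel_entropy_defined_def)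
    have KL_nonneg_P: "0 \<le> KL Q P" if "Q \<in> borel_probs" for Q :: "'a measure"
      using borel_probsD[OF P] borel_probsD[OF that] by (intro KL_nonneg) auto
    have KL_T_nonneg: "0 \<le> KL T (joint P)" if "T \<in> couplings P' Q" for T and Q :: "'a measure"
      using couplingsD[OF that] by (intro KL_nonneg prob_space_joint P) (simp_all add: sets_joint[OF P])
    have rate_nonneg: "0 \<le> rate Obs P' P"
      unfolding rate_def using borel_probsD[OF P'] borel_probsD[OF observation_borel_probs[OF Obs P]]
      by (intro KL_nonneg) auto
    note objective = eot_objective_eq_KL_joint[OF P _ _ ac qi]
    consider "?H = - \<infinity>" | "?H = \<infinity>" | h where "?H = ereal h"
      by (cases ?H) auto
    then show ?thesis
    proof cases
      case 1
      \<comment> \<open>Impossible: with \<open>Q = P\<close>, the sum of \<open>KL(P', m')\<close> and the transport value would be \<open>-\<infinity> + \<infinity>\<close>.\<close>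
      have "eot_objective d T = \<infinity>" if T: "T \<in> couplings P' P" for T
      proof (cases "absolutely_continuous (P \<Otimes>\<^sub>M P') T")
        case True
        then show ?thesis
          using objective[OF T _ _ True] KL_T_nonneg[OF T] 1
          by (simp add: KL_self borel_probsD(1)[OF P] sum_defined_def)
      next
        case False
        then show ?thesis
          by (simp add: eot_objective_eq[OF T d])
      qed
      then have "eot d P' P = \<infinity>"
        by (simp add: eot_def top_ereal_def[symmetric])
      then have False
        using sum[OF P] 1 by (simp add: KL_self borel_probsD(1)[OF P] sum_defined_def)
      then show ?thesis ..
    next
      case 2
      \<comment> \<open>A finite rate would give the tilted coupling objective \<open>-\<infinity>\<close>, so the sum would be \<open>\<infinity> - \<infinity>\<close>.\<close>
      have "rate Obs P' P = \<infinity>"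
      proof (rule ccontr)
        assume "rate Obs P' P \<noteq> \<infinity>"
        then have fin: "rate Obs P' P < \<infinity>" by simp
        obtain Q T where QT: "Q \<in> borel_probs" "T \<in> couplings P' Q" "KL Q P < \<infinity>"
          "KL T (joint P) = rate Obs P' P" "absolutely_continuous (Q \<Otimes>\<^sub>M P') T"
          by (rule tilted_coupling[OF P P' ac fin])
        have "eot_objective d T = - \<infinity>"
          using objective[OF QT(2,3) _ QT(5)] QT(3,4) KL_nonneg_P[OF QT(1)] fin rate_nonneg 2
          by (cases "KL Q P"; cases "rate Obs P' P") (simp_all add: sum_defined_def)
        then have "eot d P' Q = - \<infinity>"
          unfolding eot_def using QT(2) by (metis INF_lower ereal_infty_less_eq(2))
        then show False
          using sum[OF QT(1,3)] 2 by (simp add: sum_defined_def)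
      qed
      then show ?thesis
        using INF_infinite[OF 2] by simp
    next
      case 3
      show ?thesis
      proof (rule antisym)
        show "rate Obs P' P \<le> (INF Q\<in>borel_probs. KL Q P + ?H + eot d P' Q)"
        proof (rule INF_greatest)
          fix Q :: "'a measure" assume Q: "Q \<in> borel_probs"
          show "rate Obs P' P \<le> KL Q P + ?H + eot d P' Q"
          proof (cases "KL Q P")
            case (real k)
            have "rate Obs P' P - ereal (k + h) \<le> eot_objective d T" if T: "T \<in> couplings P' Q" for T
            proof (cases "absolutely_continuous (Q \<Otimes>\<^sub>M P') T")
              case True
              then have "eot_objective d T = KL T (joint P) + - ereal k + - ereal h"
                using objective[OF T _ _ True] real 3 by (simp add: sum_defined_def)
              then show ?thesis
                using rate_le_KL_joint[OF P T]
                by (cases "rate Obs P' P"; cases "KL T (joint P)") auto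
            next
              case False
              then show ?thesis
                by (simp add: eot_objective_eq[OF T d])
            qed
            then have "rate Obs P' P - ereal (k + h) \<le> eot d P' Q"
              unfolding eot_def by (rule INF_greatest)
            then show ?thesis
              unfolding real 3 by (cases "rate Obs P' P"; cases "eot d P' Q") auto
          qed (use KL_nonneg_P[OF Q] in auto)
        qed
        show "(INF Q\<in>borel_probs. KL Q P + ?H + eot d P' Q) \<le> rate Obs P' P"
        proof (cases "rate Obs P' P < \<infinity>")
          case fin: True
          obtain Q T where QT: "Q \<in> borel_probs" "T \<in> couplings P' Q" "KL Q P < \<infinity>"
            "KL T (joint P) = rate Obs P' P" "absolutely_continuous (Q \<Otimes>\<^sub>M P') T"
            by (rule tilted_coupling[OF P P' ac fin])
          have "(INF Q\<in>borel_probs. KL Q P + ?H + eot d P' Q) \<le> KL Q P + ?H + eot d P' Q"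
            using QT(1) by (rule INF_lower)
          also have "\<dots> \<le> KL Q P + ?H + eot_objective d T"
            unfolding eot_def using QT(2) by (intro add_left_mono INF_lower)
          also have "\<dots> = rate Obs P' P"
            using objective[OF QT(2,3) _ QT(5)] QT(3,4) KL_nonneg_P[OF QT(1)] fin rate_nonneg 3
            by (cases "KL Q P"; cases "rate Obs P' P") (simp_all add: sum_defined_def)
          finally show ?thesis .
        qed simp
      qed
    qed
  qed
qed

end

theorem theorem2p10:
  fixes Obs :: "'a::polish_space \<Rightarrow> 'b::polish_space measure"
    and m' :: "'b measure"
    and d :: "'a \<times> 'b \<Rightarrow> real"
  assumes "Obs \<in> borel \<rightarrow>\<^sub>M prob_algebra borel"
    and "sets m' = sets borel"
    and "\<And>\<xi>. absolutely_continuous m' (Obs \<xi>)"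
    and "d \<in> borel_measurable borel"
    and "\<And>\<xi>. AE \<xi>' in m'. RN_deriv m' (Obs \<xi>) \<xi>' = ennreal (exp (- d (\<xi>, \<xi>')))"
  shows "(\<forall>P1'\<in>borel_probs. \<forall>P2'\<in>borel_probs. \<forall>P1\<in>borel_probs. \<forall>P2\<in>borel_probs. \<forall>t\<in>{0..1}.
            rate Obs (mixture t P1' P2') (mixture t P1 P2)
              \<le> ereal (1 - t) * rate Obs P1' P1 + ereal t * rate Obs P2' P2)
       \<and> (\<forall>P'\<in>borel_probs. \<forall>P\<in>borel_probs. 0 \<le> rate Obs P' P)
       \<and> (\<forall>P'\<in>borel_probs. \<forall>P\<in>borel_probs.
            rel_entropy_defined P' m' \<and>
            (\<forall>Q\<in>borel_probs. KL Q P < \<infinity> \<longrightarrow> sum_defined (rel_entropy P' m') (eot d P' Q)) \<longrightarrow>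
            rate Obs P' P = (INF Q\<in>borel_probs. KL Q P + rel_entropy P' m' + eot d P' Q))"
proof -
  have d_sec: "(\<lambda>\<xi>'. exp (- d (\<xi>, \<xi>'))) \<in> borel_measurable m'" for \<xi>
  proof -
    have "(\<lambda>\<xi>'. d (\<xi>, \<xi>')) \<in> borel_measurable borel"
      by (rule measurable_compose[OF _ assms(4)]) (simp cong: measurable_cong_sets flip: sets_borel_prod)
    then show ?thesis
      by (simp cong: measurable_cong_sets add: assms(2))
  qed
  have "prob_space (Obs \<xi>)" "sets (Obs \<xi>) = sets m'" for \<xi>
    using measurable_space[OF assms(1), of \<xi>] by (simp_all add: space_prob_algebra assms(2))
  note base = density_base_measure[OF this assms(3) d_sec exp_gt_zero assms(5)]
  interpret gibbs_kernel Obs m' d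
    using assms(1,2,4) base by (intro gibbs_kernel.intro)
  have "0 \<le> rate Obs P' P" if "P' \<in> borel_probs" "P \<in> borel_probs" for P' P
    unfolding rate_def using borel_probsD[OF that(1)] borel_probsD[OF observation_borel_probs[OF Obs that(2)]]
    by (intro KL_nonneg) auto
  then show ?thesis
  proof (intro conjI ballI impI)
    fix P1' P2' :: "'b measure" and P1 P2 :: "'a measure" and t :: real
    assume "P1' \<in> borel_probs" "P2' \<in> borel_probs" "P1 \<in> borel_probs" "P2 \<in> borel_probs" "t \<in> {0..1}"
    then show "rate Obs (mixture t P1' P2') (mixture t P1 P2)
        \<le> ereal (1 - t) * rate Obs P1' P1 + ereal t * rate Obs P2' P2"
      by (intro rate_jointly_convex assms(1)) simp_all
  next
    fix P' :: "'b measure" and P :: "'a measure"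
    assume P': "P' \<in> borel_probs" and P: "P \<in> borel_probs"
    assume "rel_entropy_defined P' m' \<and>
        (\<forall>Q\<in>borel_probs. KL Q P < \<infinity> \<longrightarrow> sum_defined (rel_entropy P' m') (eot d P' Q))"
    then show "rate Obs P' P = (INF Q\<in>borel_probs. KL Q P + rel_entropy P' m' + eot d P' Q)"
      by (intro rate_decomposition P' P) blast+
  qed
qed

end
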